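(* Let $\mathbf{V}=\{V^n\}_{n=1}^\infty$ be a general source and $\mathbf{W}=\{W^n\}_{n=1}^\infty$ a general channel, and suppose that either the source $\mathbf{V}$ or the channel $\mathbf{W}$ satisfies the semi-strong converse property. Then the following two statements hold: 1) If $R_f(\mathbf{V})<C(\mathbf{W})$, then the source $\mathbf{V}$ is transmissible over the channel $\mathbf{W}$. In this case, the source coding and the channel coding can be separated (that is, transmissibility is achieved by two-step encoding). 2) If the source $\mathbf{V}$ is transmissible over the channel $\mathbf{W}$, then $R_f(\mathbf{V})\le C(\mathbf{W})$.
   Context: A general source $\mathbf{V}=\{V^n\}_{n=1}^\infty$ is an arbitrary sequence of random variables $V^n=(V_1^{(n)},\dots,V_n^{(n)})$ with values in $\mathcal{V}^n$, where the source alphabet $\mathcal{V}$ is a countably infinite set; no consistency between different $n$ is required. A general channel $\mathbf{W}=\{W^n(\cdot|\cdot):\mathcal{X}^n\to\mathcal{Y}^n\}_{n=1}^\infty$ is an arbitrary sequence of transition probabilities (Markov kernels) $W^n$ from $\mathcal{X}^n$ to $\mathcal{Y}^n$, where $\mathcal{X},\mathcal{Y}$ are arbitrary abstract (measurable) alphabets. $P_Z$ denotes the distribution of $Z$. Logarithms are natural. A channel input $\mathbf{X}=\{X^n\}_{n=1}^\infty$ is a sequence of random variables $X^n$ with values in $\mathcal{X}^n$; $Y^n$ is the channel output via $W^n$ due to the input $X^n$ (conditional distribution of $Y^n$ given $X^n=\mathbf{x}$ is $W^n(\cdot|\mathbf{x})$), and $\mathbf{Y}=\{Y^n\}_{n=1}^\infty$.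 For abstract alphabets, $\frac{W^n(Y^n|X^n)}{P_{Y^n}(Y^n)}$ means $g(Y^n|X^n)$ with $g(\mathbf{y}|\mathbf{x})=\frac{W^n(d\mathbf{y}|\mathbf{x})}{P_{Y^n}(d\mathbf{y})}=\frac{P_{X^nY^n}(d\mathbf{x},d\mathbf{y})}{P_{X^n}(d\mathbf{x})P_{Y^n}(d\mathbf{y})}$ the Radon-Nikodym derivative, measurable in $(\mathbf{x},\mathbf{y})$. For real-valued random variables $Z_n$: $\text{p-}\limsup_{n\to\infty}Z_n=\inf\{\beta:\lim_{n\to\infty}\Pr\{Z_n>\beta\}=0\}$ and $\text{p-}\liminf_{n\to\infty}Z_n=\sup\{\alpha:\lim_{n\to\infty}\Pr\{Z_n<\alpha\}=0\}$. Put $\overline{H}(\mathbf{V})=\text{p-}\limsup_{n\to\infty}\frac1n\log\frac1{P_{V^n}(V^n)}$ and $\underline{I}(\mathbf{X};\mathbf{Y})=\text{p-}\liminf_{n\to\infty}\frac1n\log\frac{W^n(Y^n|X^n)}{P_{Y^n}(Y^n)}$. Semi-strong converse property. The source $\mathbf{V}$ satisfies it if for all sequences of positive integers $n_1<n_2<\cdots\to\infty$, $$\text{p-}\limsup_{i\to\infty}\frac1{n_i}\log\frac1{P_{V^{n_i}}(V^{n_i})}=\overline{H}(\mathbf{V}).$$ The channel $\mathbf{W}$ satisfies it if for any channel input $\mathbf{X}=\{X^n\}_{n=1}^\infty$ and all sequences of positive integers $n_1<n_2<\cdots\to\infty$, $$\text{p-}\liminf_{i\to\infty}\frac1{n_i}\log\frac{W^{n_i}(Y^{n_i}|X^{n_i})}{P_{Y^{n_i}}(Y^{n_i})}\le\sup_{\mathbf{X}}\underline{I}(\mathbf{X};\mathbf{Y}),$$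 the supremum being over all channel inputs. Transmissibility: a joint source-channel $(n,\varepsilon_n)$ code is a pair of an encoder $\varphi_n:\mathcal{V}^n\to\mathcal{X}^n$ and a decoder $\psi_n:\mathcal{Y}^n\to\mathcal{V}^n$ (deterministic maps) whose probability of decoding error is $\varepsilon_n=\sum_{\mathbf{v}\in\mathcal{V}^n}P_{V^n}(\mathbf{v})\,W^n(\mathcal{D}^c(\mathbf{v})|\varphi_n(\mathbf{v}))$, where $\mathcal{D}(\mathbf{v})=\{\mathbf{y}\in\mathcal{Y}^n:\psi_n(\mathbf{y})=\mathbf{v}\}$. $\mathbf{V}$ is transmissible over $\mathbf{W}$ if there exists a sequence of $(n,\varepsilon_n)$ codes with $\lim_{n\to\infty}\varepsilon_n=0$. Source coding: a fixed-length source code with $M_n$ codewords is a pair of maps $f_n:\mathcal{V}^n\to\{1,\dots,M_n\}$, $g_n:\{1,\dots,M_n\}\to\mathcal{V}^n$, with error probability $\Pr\{g_n(f_n(V^n))\ne V^n\}$. A rate $R$ is achievable if there are such codes with error probability tending to $0$ and $\limsup_{n\to\infty}\frac1n\log M_n\le R$; $R_f(\mathbf{V})$ is the infimum of all achievable rates. Channel coding: a channel code with $M_n$ messages is a pair of maps $e_n:\{1,\dots,M_n\}\to\mathcal{X}^n$, $d_n:\mathcal{Y}^n\to\{1,\dots,M_n\}$, with (average) error probability $\frac1{M_n}\sum_{i=1}^{M_n}W^n(\{\mathbf{y}:d_n(\mathbf{y})\ne i\}|e_n(i))$. A rate $R$ is achievable if there are such codes with error probability tending to $0$ and $\liminf_{n\to\infty}\frac1n\log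 M_n\ge R$; the capacity $C(\mathbf{W})$ is the supremum of all achievable rates. Two-step encoding (separation of codings): there are integers $M_n$, fixed-length source codes $(f_n,g_n)$ with $M_n$ codewords whose error probability tends to $0$, and channel codes $(e_n,d_n)$ with $M_n$ messages whose maximum error probability $\max_i W^n(\{\mathbf{y}:d_n(\mathbf{y})\ne i\}|e_n(i))$ tends to $0$; the joint code is $\varphi_n=e_n\circ f_n$, $\psi_n=g_n\circ d_n$. *)

theory Defs
  imports "HOL-Probability.Probability"
begin

section \<open>Radon--Nikodym derivatives without absolute continuity\<close>

text \<open>
  The joint law of channel input and output need not be absolutely continuous with respect to the
  product of its marginals (for example \<open>Y = X\<close> with \<open>X\<close> uniform on an interval). As usual in the
  information-spectrum approach, the density is then taken to be \<open>\<infinity>\<close> on the set carrying the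
  singular part. For an absolutely continuous \<open>N\<close> it is the library's \<open>RN_deriv M N\<close>, see
  \<open>ext_RN_deriv_absolutely_continuous\<close>; in general it is determined almost everywhere with
  respect to both \<open>M\<close> and \<open>N\<close>.
\<close>

definition singular_set :: "'a measure \<Rightarrow> 'a measure \<Rightarrow> 'a set" where
  "singular_set M N = (SOME S. S \<in> null_sets M \<and>
     absolutely_continuous M (density N (indicator (space M - S))))"

definition ext_RN_deriv :: "'a measure \<Rightarrow> 'a measure \<Rightarrow> 'a \<Rightarrow> ennreal" where
  "ext_RN_deriv M N x =
     (if x \<in> singular_set M N then \<infinity>
      else RN_deriv M (density N (indicator (space M - singular_set M N))) x)"

lemma singular_set_exists:
  assumes N: "finite_measure N" and sets: "sets N = sets M"
  shows "\<exists>S. S \<in> null_sets M \<and> absolutely_continuous M (density N (indicator (space M - S)))"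
proof -
  interpret N: finite_measure N by (rule N)
  have ne: "null_sets M \<noteq> {}" by auto
  obtain s where s: "range s \<subseteq> emeasure N ` null_sets M"
    and sup: "(SUP T\<in>null_sets M. emeasure N T) = (SUP i::nat. s i)"
    using ennreal_SUP_countable_SUP[OF ne, of "emeasure N"] by auto
  have "\<forall>i. \<exists>T\<in>null_sets M. s i = emeasure N T" using s by blast
  then obtain T where T: "\<And>i. T i \<in> null_sets M" "\<And>i. s i = emeasure N (T i)" by metis
  define S where "S = (\<Union>i. T i)"
  have S: "S \<in> null_sets M" unfolding S_def using T by auto
  have max: "emeasure N A \<le> emeasure N S" if "A \<in> null_sets M" for A
  proof -
    have "emeasure N A \<le> (SUP i. s i)" unfolding sup[symmetric] using that by (rule SUP_upper)
    also have "\<dots> \<le> emeasure N S"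
    proof (rule SUP_least)
      fix i
      show "s i \<le> emeasure N S"
        using T S by (auto simp: S_def sets null_sets_def intro!: emeasure_mono)
    qed
    finally show ?thesis .
  qed
  have "absolutely_continuous M (density N (indicator (space M - S)))"
    unfolding absolutely_continuous_def
  proof
    fix A assume A: "A \<in> null_sets M"
    have mS: "S \<in> sets N" and mA: "A \<in> sets N" using S A by (auto simp: null_sets_def sets)
    have sp: "space N = space M" using sets by (rule sets_eq_imp_space_eq)
    have sub: "A \<subseteq> space M" using mA sets.sets_into_space[of A N] sp by auto
    have "A - S \<union> S \<in> null_sets M" using A S by auto
    then have "emeasure N (A - S \<union> S) \<le> emeasure N S" by (rule max)
    moreover have "emeasure N (A - S \<union> S) = emeasure N (A - S) + emeasure N S"
      using mS mA by (intro plus_emeasure[symmetric]) auto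
    ultimately have "emeasure N S + emeasure N (A - S) \<le> emeasure N S + 0"
      by (simp add: add.commute)
    then have "emeasure N (A - S) = 0"
      using N.emeasure_finite[of S] by (simp only: ennreal_add_left_cancel_le) auto
    moreover have "emeasure (density N (indicator (space M - S))) A = emeasure N (A - S)"
    proof -
      have "emeasure (density N (indicator (space M - S))) A
            = (\<integral>\<^sup>+x. indicator (space M - S) x * indicator A x \<partial>N)"
        using mA sp sets.compl_sets[OF mS] by (subst emeasure_density) auto
      also have "\<dots> = (\<integral>\<^sup>+x. indicator (A - S) x \<partial>N)"
        using sub by (intro nn_integral_cong) (auto split: split_indicator)
      finally show ?thesis using mS mA by simp
    qed
    ultimately show "A \<in> null_sets (density N (indicator (space M - S)))"
      using mA by (auto simp: null_sets_def)
  qed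
  with S show ?thesis by blast
qed

lemma ext_RN_deriv_absolutely_continuous:
  assumes "finite_measure M" "finite_measure N" "sets N = sets M" "absolutely_continuous M N"
  shows "AE x in M. ext_RN_deriv M N x = RN_deriv M N x"
proof -
  let ?S = "singular_set M N"
  have S: "?S \<in> null_sets M"
    using someI_ex[OF singular_set_exists[OF assms(2,3)]] unfolding singular_set_def by blast
  then have SN: "?S \<in> null_sets N" using assms(4) unfolding absolutely_continuous_def by auto
  have sp: "space N = space M" using assms(3) by (rule sets_eq_imp_space_eq)
  have "density N (indicator (space M - ?S)) = density N (\<lambda>_. 1)"
  proof (rule density_cong)
    have "space M - ?S \<in> sets N" using SN sets.compl_sets[of ?S N] sp by auto
    then show "(indicator (space M - ?S) :: _ \<Rightarrow> ennreal) \<in> borel_measurable N" by auto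
    show "AE x in N. indicator (space M - ?S) x = (1::ennreal)"
      using AE_not_in[OF SN] AE_space by eventually_elim (auto simp: sp)
  qed simp
  then have "density N (indicator (space M - ?S)) = N" by (simp add: density_1)
  then show ?thesis using AE_not_in[OF S]
    by (auto simp: ext_RN_deriv_def elim: eventually_mono)
qed

definition ln_ennreal :: "ennreal \<Rightarrow> ereal" where
  "ln_ennreal a = (if a = 0 then -\<infinity> else if a = \<infinity> then \<infinity> else ereal (ln (enn2real a)))"

section \<open>Limits in probability\<close>

text \<open>
  \<open>Z n\<close> is a random variable on the probability space \<open>M n\<close>; the spaces for different \<open>n\<close>
  are unrelated.
\<close>

definition p_limsup :: "(nat \<Rightarrow> 'a measure) \<Rightarrow> (nat \<Rightarrow> 'a \<Rightarrow> ereal) \<Rightarrow> ereal" where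
  "p_limsup M Z = Inf {ereal \<beta> |\<beta>. (\<lambda>n. \<P>(\<omega> in M n. Z n \<omega> > ereal \<beta>)) \<longlonglongrightarrow> 0}"

definition p_liminf :: "(nat \<Rightarrow> 'a measure) \<Rightarrow> (nat \<Rightarrow> 'a \<Rightarrow> ereal) \<Rightarrow> ereal" where
  "p_liminf M Z = Sup {ereal \<alpha> |\<alpha>. (\<lambda>n. \<P>(\<omega> in M n. Z n \<omega> < ereal \<alpha>)) \<longlonglongrightarrow> 0}"

section \<open>General sources\<close>

text \<open>
  Sources, channels and codes are sequences indexed by the block length \<open>n \<ge> 1\<close>; their values at
  \<open>n = 0\<close> are irrelevant. A source is given by the laws \<open>V n\<close> of its blocks, which are lists of
  length \<open>n\<close> over the type of source letters.
\<close>

definition words :: "nat \<Rightarrow> 'v list set" where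
  "words n = {v. length v = n}"

definition general_source :: "(nat \<Rightarrow> 'v list pmf) \<Rightarrow> bool" where
  "general_source V \<longleftrightarrow> (\<forall>n\<ge>1. set_pmf (V n) \<subseteq> words n)"

definition entropy_rate :: "(nat \<Rightarrow> 'v list pmf) \<Rightarrow> nat \<Rightarrow> 'v list \<Rightarrow> ereal" where
  "entropy_rate V n v = ereal (1 / real n * ln (1 / pmf (V n) v))"

definition sup_entropy_rate :: "(nat \<Rightarrow> 'v list pmf) \<Rightarrow> ereal" where
  "sup_entropy_rate V = p_limsup (\<lambda>n. measure_pmf (V n)) (entropy_rate V)"

definition semi_strong_converse_source :: "(nat \<Rightarrow> 'v list pmf) \<Rightarrow> bool" where
  "semi_strong_converse_source V \<longleftrightarrow>
     (\<forall>k::nat \<Rightarrow> nat. strict_mono k \<and> (\<forall>i. k i \<ge> 1) \<longrightarrow>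
        p_limsup (\<lambda>i. measure_pmf (V (k i))) (\<lambda>i. entropy_rate V (k i)) = sup_entropy_rate V)"

section \<open>General channels\<close>

abbreviation block :: "'a measure \<Rightarrow> nat \<Rightarrow> (nat \<Rightarrow> 'a) measure" where
  "block A n \<equiv> PiM {..<n} (\<lambda>_. A)"

definition general_channel ::
  "'x measure \<Rightarrow> 'y measure \<Rightarrow> (nat \<Rightarrow> (nat \<Rightarrow> 'x) \<Rightarrow> (nat \<Rightarrow> 'y) measure) \<Rightarrow> bool" where
  "general_channel A B W \<longleftrightarrow> (\<forall>n\<ge>1. W n \<in> block A n \<rightarrow>\<^sub>M prob_algebra (block B n))"

text \<open>A channel input is given by the laws of its blocks, since all notions depend only on these.\<close>

definition channel_inputs :: "'x measure \<Rightarrow> (nat \<Rightarrow> (nat \<Rightarrow> 'x) measure) set" where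
  "channel_inputs A = {X. \<forall>n\<ge>1. X n \<in> space (prob_algebra (block A n))}"

definition output_dist :: "'a measure \<Rightarrow> ('a \<Rightarrow> 'b measure) \<Rightarrow> 'b measure" where
  "output_dist P K = P \<bind> K"

definition joint_dist ::
  "'a measure \<Rightarrow> 'b measure \<Rightarrow> 'a measure \<Rightarrow> ('a \<Rightarrow> 'b measure) \<Rightarrow> ('a \<times> 'b) measure" where
  "joint_dist A B P K = P \<bind> (\<lambda>x. distr (K x) (A \<Otimes>\<^sub>M B) (Pair x))"

abbreviation block_joint_dist ::
  "'x measure \<Rightarrow> 'y measure \<Rightarrow> (nat \<Rightarrow> (nat \<Rightarrow> 'x) \<Rightarrow> (nat \<Rightarrow> 'y) measure) \<Rightarrow>
   (nat \<Rightarrow> (nat \<Rightarrow> 'x) measure) \<Rightarrow> nat \<Rightarrow> ((nat \<Rightarrow> 'x) \<times> (nat \<Rightarrow> 'y)) measure" where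
  "block_joint_dist A B W X n \<equiv> joint_dist (block A n) (block B n) (X n) (W n)"

definition information_rate ::
  "'x measure \<Rightarrow> 'y measure \<Rightarrow> (nat \<Rightarrow> (nat \<Rightarrow> 'x) \<Rightarrow> (nat \<Rightarrow> 'y) measure) \<Rightarrow>
   (nat \<Rightarrow> (nat \<Rightarrow> 'x) measure) \<Rightarrow> nat \<Rightarrow> (nat \<Rightarrow> 'x) \<times> (nat \<Rightarrow> 'y) \<Rightarrow> ereal" where
  "information_rate A B W X n z =
     ereal (1 / real n) *
       ln_ennreal (ext_RN_deriv (X n \<Otimes>\<^sub>M output_dist (X n) (W n)) (block_joint_dist A B W X n) z)"

definition inf_information_rate ::
  "'x measure \<Rightarrow> 'y measure \<Rightarrow> (nat \<Rightarrow> (nat \<Rightarrow> 'x) \<Rightarrow> (nat \<Rightarrow> 'y) measure) \<Rightarrow>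
   (nat \<Rightarrow> (nat \<Rightarrow> 'x) measure) \<Rightarrow> ereal" where
  "inf_information_rate A B W X = p_liminf (block_joint_dist A B W X) (information_rate A B W X)"

definition semi_strong_converse_channel ::
  "'x measure \<Rightarrow> 'y measure \<Rightarrow> (nat \<Rightarrow> (nat \<Rightarrow> 'x) \<Rightarrow> (nat \<Rightarrow> 'y) measure) \<Rightarrow> bool" where
  "semi_strong_converse_channel A B W \<longleftrightarrow>
     (\<forall>X\<in>channel_inputs A. \<forall>k::nat \<Rightarrow> nat. strict_mono k \<and> (\<forall>i. k i \<ge> 1) \<longrightarrow>
        p_liminf (\<lambda>i. block_joint_dist A B W X (k i)) (\<lambda>i. information_rate A B W X (k i))
          \<le> (SUP X'\<in>channel_inputs A. inf_information_rate A B W X'))"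

section \<open>Fixed-length source coding\<close>

definition source_code ::
  "nat \<Rightarrow> nat \<Rightarrow> ('v list \<Rightarrow> nat) \<Rightarrow> (nat \<Rightarrow> 'v list) \<Rightarrow> bool" where
  "source_code n m f g \<longleftrightarrow> f \<in> words n \<rightarrow> {1..m} \<and> g \<in> {1..m} \<rightarrow> words n"

definition source_error :: "'v list pmf \<Rightarrow> ('v list \<Rightarrow> nat) \<Rightarrow> (nat \<Rightarrow> 'v list) \<Rightarrow> real" where
  "source_error P f g = \<P>(v in measure_pmf P. g (f v) \<noteq> v)"

definition achievable_source_rate :: "(nat \<Rightarrow> 'v list pmf) \<Rightarrow> real \<Rightarrow> bool" where
  "achievable_source_rate V R \<longleftrightarrow>
     (\<exists>M f g. (\<forall>n\<ge>1. source_code n (M n) (f n) (g n)) \<and>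
        (\<lambda>n. source_error (V n) (f n) (g n)) \<longlonglongrightarrow> 0 \<and>
        limsup (\<lambda>n. ereal (1 / real n * ln (real (M n)))) \<le> ereal R)"

definition source_coding_rate :: "(nat \<Rightarrow> 'v list pmf) \<Rightarrow> ereal" where
  "source_coding_rate V = Inf {ereal R |R. achievable_source_rate V R}"

section \<open>Channel coding\<close>

text \<open>
  Decoders are measurable, so that the error probabilities are defined. In \<open>channel_code\<close>
  the arguments \<open>A\<close> and \<open>B\<close> are the spaces of input and output blocks, not of letters.
\<close>

definition channel_code ::
  "'a measure \<Rightarrow> 'b measure \<Rightarrow> nat \<Rightarrow> (nat \<Rightarrow> 'a) \<Rightarrow> ('b \<Rightarrow> nat) \<Rightarrow> bool" where
  "channel_code A B m e d \<longleftrightarrow>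
     m \<ge> 1 \<and> e \<in> {1..m} \<rightarrow> space A \<and> d \<in> B \<rightarrow>\<^sub>M count_space {1..m}"

definition channel_message_error ::
  "('a \<Rightarrow> 'b measure) \<Rightarrow> (nat \<Rightarrow> 'a) \<Rightarrow> ('b \<Rightarrow> nat) \<Rightarrow> nat \<Rightarrow> real" where
  "channel_message_error K e d i = \<P>(y in K (e i). d y \<noteq> i)"

definition channel_avg_error ::
  "('a \<Rightarrow> 'b measure) \<Rightarrow> nat \<Rightarrow> (nat \<Rightarrow> 'a) \<Rightarrow> ('b \<Rightarrow> nat) \<Rightarrow> real" where
  "channel_avg_error K m e d = 1 / real m * (\<Sum>i=1..m. channel_message_error K e d i)"

definition channel_max_error ::
  "('a \<Rightarrow> 'b measure) \<Rightarrow> nat \<Rightarrow> (nat \<Rightarrow> 'a) \<Rightarrow> ('b \<Rightarrow> nat) \<Rightarrow> real" where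
  "channel_max_error K m e d = (MAX i\<in>{1..m}. channel_message_error K e d i)"

definition achievable_channel_rate ::
  "'x measure \<Rightarrow> 'y measure \<Rightarrow> (nat \<Rightarrow> (nat \<Rightarrow> 'x) \<Rightarrow> (nat \<Rightarrow> 'y) measure) \<Rightarrow> real \<Rightarrow> bool" where
  "achievable_channel_rate A B W R \<longleftrightarrow>
     (\<exists>M e d. (\<forall>n\<ge>1. channel_code (block A n) (block B n) (M n) (e n) (d n)) \<and>
        (\<lambda>n. channel_avg_error (W n) (M n) (e n) (d n)) \<longlonglongrightarrow> 0 \<and>
        liminf (\<lambda>n. ereal (1 / real n * ln (real (M n)))) \<ge> ereal R)"

definition capacity ::
  "'x measure \<Rightarrow> 'y measure \<Rightarrow> (nat \<Rightarrow> (nat \<Rightarrow> 'x) \<Rightarrow> (nat \<Rightarrow> 'y) measure) \<Rightarrow> ereal" where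
  "capacity A B W = Sup {ereal R |R. achievable_channel_rate A B W R}"

section \<open>Joint source-channel coding\<close>

definition joint_code ::
  "'x measure \<Rightarrow> 'y measure \<Rightarrow> nat \<Rightarrow> ('v list \<Rightarrow> nat \<Rightarrow> 'x) \<Rightarrow> ((nat \<Rightarrow> 'y) \<Rightarrow> 'v list) \<Rightarrow> bool" where
  "joint_code A B n \<phi> \<psi> \<longleftrightarrow>
     \<phi> \<in> words n \<rightarrow> space (block A n) \<and> \<psi> \<in> block B n \<rightarrow>\<^sub>M count_space (words n)"

definition joint_error ::
  "'v list pmf \<Rightarrow> ((nat \<Rightarrow> 'x) \<Rightarrow> (nat \<Rightarrow> 'y) measure) \<Rightarrow> nat \<Rightarrow>
   ('v list \<Rightarrow> nat \<Rightarrow> 'x) \<Rightarrow> ((nat \<Rightarrow> 'y) \<Rightarrow> 'v list) \<Rightarrow> real" where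
  "joint_error P K n \<phi> \<psi> = (\<Sum>\<^sub>\<infinity>v\<in>words n. pmf P v * \<P>(y in K (\<phi> v). \<psi> y \<noteq> v))"

definition transmits ::
  "(nat \<Rightarrow> 'v list pmf) \<Rightarrow> 'x measure \<Rightarrow> 'y measure \<Rightarrow>
   (nat \<Rightarrow> (nat \<Rightarrow> 'x) \<Rightarrow> (nat \<Rightarrow> 'y) measure) \<Rightarrow>
   (nat \<Rightarrow> 'v list \<Rightarrow> nat \<Rightarrow> 'x) \<Rightarrow> (nat \<Rightarrow> (nat \<Rightarrow> 'y) \<Rightarrow> 'v list) \<Rightarrow> bool" where
  "transmits V A B W \<phi> \<psi> \<longleftrightarrow>
     (\<forall>n\<ge>1. joint_code A B n (\<phi> n) (\<psi> n)) \<and>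
     (\<lambda>n. joint_error (V n) (W n) n (\<phi> n) (\<psi> n)) \<longlonglongrightarrow> 0"

definition transmissible ::
  "(nat \<Rightarrow> 'v list pmf) \<Rightarrow> 'x measure \<Rightarrow> 'y measure \<Rightarrow>
   (nat \<Rightarrow> (nat \<Rightarrow> 'x) \<Rightarrow> (nat \<Rightarrow> 'y) measure) \<Rightarrow> bool" where
  "transmissible V A B W \<longleftrightarrow> (\<exists>\<phi> \<psi>. transmits V A B W \<phi> \<psi>)"

definition two_step_transmissible ::
  "(nat \<Rightarrow> 'v list pmf) \<Rightarrow> 'x measure \<Rightarrow> 'y measure \<Rightarrow>
   (nat \<Rightarrow> (nat \<Rightarrow> 'x) \<Rightarrow> (nat \<Rightarrow> 'y) measure) \<Rightarrow> bool" where
  "two_step_transmissible V A B W \<longleftrightarrow>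
     (\<exists>M f g e d.
        (\<forall>n\<ge>1. source_code n (M n) (f n) (g n)) \<and>
        (\<lambda>n. source_error (V n) (f n) (g n)) \<longlonglongrightarrow> 0 \<and>
        (\<forall>n\<ge>1. channel_code (block A n) (block B n) (M n) (e n) (d n)) \<and>
        (\<lambda>n. channel_max_error (W n) (M n) (e n) (d n)) \<longlonglongrightarrow> 0 \<and>
        transmits V A B W (\<lambda>n. e n \<circ> f n) (\<lambda>n. g n \<circ> d n))"

end

theory Submission
  imports Defs
begin

text \<open>
  Below capacity, coding in two steps works because the list of source messages fits into a channel
  code. A channel code of rate above that of the source code has, for large \<open>n\<close>, more than twice as
  many messages, so discarding its worse half leaves enough of them and turns a small average error
  into a small maximum error. The error of the composed code is at most the sum of the two errors
  (\<open>expurgated_code\<close>, \<open>two_step_joint_error\<close>).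

  For the second claim the sup-entropy rate \<open>H\<close> of the source lies between the two rates. That the
  source coding rate is at most \<open>H\<close> is seen by listing the words of probability at least
  \<open>exp (- n \<beta>)\<close> for an admissible \<open>\<beta>\<close>. That \<open>H\<close> is at most the capacity when the source is
  transmissible starts from one observation (\<open>channel_code_of_joint_code\<close>): if words of probability
  at most \<open>exp (- n R)\<close> have total probability at least \<open>\<delta>\<close>, then by Markov's inequality those among
  them which the joint code decodes reliably have total probability at least \<open>\<delta> / 2\<close>. There are at
  least \<open>(\<delta> / 2) exp (n R)\<close> of them, and they are the messages of a channel code of rate about \<open>R\<close>
  whose maximum error tends to zero.

  For \<open>R < H\<close> such a \<open>\<delta>\<close> exists along some sequence of block lengths. If the source has the
  semi-strong converse property, one \<open>\<delta>\<close> serves all large block lengths, so that \<open>R\<close> is an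
  achievable channel rate. If the channel has it, let the input be uniform on the codewords along the
  sequence. A change of measure shows that the information rate of this input is asymptotically at
  least \<open>R\<close> along the sequence (\<open>uniform_codeword_density\<close>). By the converse property \<open>R\<close> is then at
  most the supremum of the inf-information rates over all inputs, and this supremum is at most the
  capacity by Feinstein's greedy code construction (\<open>inf_information_rate_le_capacity\<close>).
\<close>

section \<open>The density of the joint law with respect to the product of its marginals\<close>

lemma singular_set_null:
  assumes "finite_measure N" "sets N = sets M"
  shows "singular_set M N \<in> null_sets M"
    and "absolutely_continuous M (density N (indicator (space M - singular_set M N)))"
  using someI_ex[OF singular_set_exists[OF assms]] unfolding singular_set_def by blast+

lemma ext_RN_deriv_measurable:
  assumes "finite_measure N" "sets N = sets M"
  shows "ext_RN_deriv M N \<in> borel_measurable M"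
proof -
  have "singular_set M N \<in> sets M" using singular_set_null(1)[OF assms] by auto
  then show ?thesis unfolding ext_RN_deriv_def[abs_def] by measurable
qed

text \<open>
  Removing the singular set from \<open>N\<close> leaves an absolutely continuous measure, to which the
  Radon--Nikodym theorem applies; a set \<open>E\<close> that avoids the singular set does not see the difference.
\<close>

lemma emeasure_eq_integral_ext_RN_deriv:
  assumes M: "finite_measure M" and N: "finite_measure N" and sets: "sets N = sets M"
    and E: "E \<in> sets M" and disj: "E \<inter> singular_set M N = {}"
  shows "emeasure N E = (\<integral>\<^sup>+z. ext_RN_deriv M N z * indicator E z \<partial>M)"
proof -
  interpret M: finite_measure M by (rule M)
  let ?S = "singular_set M N" and ?N = "density N (indicator (space M - singular_set M N))"
  have S: "?S \<in> sets M" using singular_set_null(1)[OF N sets] by auto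
  have sp: "space N = space M" using sets by (rule sets_eq_imp_space_eq)
  have ind: "(indicator (space M - ?S) :: _ \<Rightarrow> ennreal) \<in> borel_measurable N"
    using S by (simp add: borel_measurable_indicator_iff sets sp)
  have sub: "E \<subseteq> space M - ?S" using sets.sets_into_space[OF E] disj by auto
  have "emeasure N E = (\<integral>\<^sup>+z. indicator E z \<partial>N)" using E sets by simp
  also have "\<dots> = (\<integral>\<^sup>+z. indicator (space M - ?S) z * indicator E z \<partial>N)"
    using sub by (intro nn_integral_cong) (auto split: split_indicator)
  also have "\<dots> = emeasure ?N E"
    using E ind by (subst emeasure_density) (auto simp: sets)
  also have "?N = density M (RN_deriv M ?N)"
    using M.density_RN_deriv[OF singular_set_null(2)[OF N sets]] sets by simp
  also have "emeasure \<dots> E = (\<integral>\<^sup>+z. RN_deriv M ?N z * indicator E z \<partial>M)"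
    using E by (subst emeasure_density) auto
  also have "\<dots> = (\<integral>\<^sup>+z. ext_RN_deriv M N z * indicator E z \<partial>M)"
    using disj by (intro nn_integral_cong) (auto simp: ext_RN_deriv_def split: split_indicator)
  finally show ?thesis .
qed

text \<open>
  A region where the density is small avoids the singular set, since the density is infinite there.
  Thus the joint law is controlled on it although it need not be absolutely continuous.
\<close>

lemma emeasure_le_of_density_less:
  assumes M: "finite_measure M" and N: "finite_measure N" and sets: "sets N = sets M"
    and E: "E \<in> sets M"
  shows "emeasure N {z\<in>E. ext_RN_deriv M N z < \<theta>} \<le> \<theta> * emeasure M E"
proof -
  have [measurable]: "ext_RN_deriv M N \<in> borel_measurable M" "E \<in> sets M"
    using ext_RN_deriv_measurable[OF N sets] E by auto
  have "{z\<in>E. ext_RN_deriv M N z < \<theta>} = E \<inter> {z\<in>space M. ext_RN_deriv M N z < \<theta>}"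
    using sets.sets_into_space[OF E] by auto
  also have "\<dots> \<in> sets M" by measurable
  finally have m: "{z\<in>E. ext_RN_deriv M N z < \<theta>} \<in> sets M" .
  have "emeasure N {z\<in>E. ext_RN_deriv M N z < \<theta>}
      = (\<integral>\<^sup>+z. ext_RN_deriv M N z * indicator {z\<in>E. ext_RN_deriv M N z < \<theta>} z \<partial>M)"
    by (rule emeasure_eq_integral_ext_RN_deriv[OF M N sets m]) (auto simp: ext_RN_deriv_def)
  also have "\<dots> \<le> (\<integral>\<^sup>+z. \<theta> * indicator E z \<partial>M)"
    by (intro nn_integral_mono) (auto split: split_indicator)
  also have "\<dots> = \<theta> * emeasure M E" using E by (simp add: nn_integral_cmult)
  finally show ?thesis .
qed

text \<open>
  In the opposite direction the singular part only helps: it adds mass to \<open>N\<close> and none to \<open>M\<close>.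
\<close>

lemma emeasure_ge_of_density_ge:
  assumes M: "finite_measure M" and N: "finite_measure N" and sets: "sets N = sets M"
    and E: "E \<in> sets M" and ge: "\<And>z. z \<in> E \<Longrightarrow> \<theta> \<le> ext_RN_deriv M N z"
  shows "\<theta> * emeasure M E \<le> emeasure N E"
proof -
  let ?S = "singular_set M N"
  have S: "?S \<in> null_sets M" using singular_set_null(1)[OF N sets] .
  then have m: "E - ?S \<in> sets M" using E by auto
  have "\<theta> * emeasure M E = \<theta> * emeasure M (E - ?S)"
    using emeasure_Diff_null_set[OF S E] by simp
  also have "\<dots> = (\<integral>\<^sup>+z. \<theta> * indicator (E - ?S) z \<partial>M)"
    using m by (simp add: nn_integral_cmult)
  also have "\<dots> \<le> (\<integral>\<^sup>+z. ext_RN_deriv M N z * indicator (E - ?S) z \<partial>M)"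
    using ge by (intro nn_integral_mono) (auto split: split_indicator)
  also have "\<dots> = emeasure N (E - ?S)"
    by (rule emeasure_eq_integral_ext_RN_deriv[OF M N sets m, symmetric]) auto
  also have "\<dots> \<le> emeasure N E" using E sets by (intro emeasure_mono) auto
  finally show ?thesis .
qed

section \<open>Joint and output laws of a kernel\<close>

lemma kernel_prob_space:
  assumes "K \<in> A \<rightarrow>\<^sub>M prob_algebra B" "x \<in> space A"
  shows "prob_space (K x)" "sets (K x) = sets B" "space (K x) = space B"
  using measurable_space[OF assms] sets_eq_imp_space_eq[of "K x" B]
  by (auto simp: space_prob_algebra)

lemma joint_kernel_measurable:
  assumes [measurable]: "K \<in> A \<rightarrow>\<^sub>M prob_algebra B"
  shows "(\<lambda>x. distr (K x) (A \<Otimes>\<^sub>M B) (Pair x)) \<in> A \<rightarrow>\<^sub>M prob_algebra (A \<Otimes>\<^sub>M B)"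
  by measurable

lemma joint_dist_prob_space:
  assumes P: "P \<in> space (prob_algebra A)" and K: "K \<in> A \<rightarrow>\<^sub>M prob_algebra B"
  shows "prob_space (joint_dist A B P K)" "sets (joint_dist A B P K) = sets (A \<Otimes>\<^sub>M B)"
    "space (joint_dist A B P K) = space (A \<Otimes>\<^sub>M B)"
proof -
  show "prob_space (joint_dist A B P K)"
    unfolding joint_dist_def by (rule prob_space_bind'[OF P joint_kernel_measurable[OF K]])
  show "sets (joint_dist A B P K) = sets (A \<Otimes>\<^sub>M B)"
    unfolding joint_dist_def by (rule sets_bind'[OF P joint_kernel_measurable[OF K]])
  then show "space (joint_dist A B P K) = space (A \<Otimes>\<^sub>M B)" by (rule sets_eq_imp_space_eq)
qed

lemma output_dist_prob_space:
  assumes P: "P \<in> space (prob_algebra A)" and K: "K \<in> A \<rightarrow>\<^sub>M prob_algebra B"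
  shows "prob_space (output_dist P K)" "sets (output_dist P K) = sets B"
    "space (output_dist P K) = space B"
proof -
  show "prob_space (output_dist P K)" unfolding output_dist_def by (rule prob_space_bind'[OF P K])
  show "sets (output_dist P K) = sets B" unfolding output_dist_def by (rule sets_bind'[OF P K])
  then show "space (output_dist P K) = space B" by (rule sets_eq_imp_space_eq)
qed

lemma input_output_product_finite:
  assumes P: "P \<in> space (prob_algebra A)" and K: "K \<in> A \<rightarrow>\<^sub>M prob_algebra B"
  shows "finite_measure (P \<Otimes>\<^sub>M output_dist P K)"
    "sets (joint_dist A B P K) = sets (P \<Otimes>\<^sub>M output_dist P K)"
proof -
  interpret P: prob_space P using P by (simp add: space_prob_algebra)
  interpret Q: prob_space "output_dist P K" by (rule output_dist_prob_space[OF P K])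
  interpret PQ: pair_prob_space P "output_dist P K" ..
  show "finite_measure (P \<Otimes>\<^sub>M output_dist P K)" by unfold_locales
  show "sets (joint_dist A B P K) = sets (P \<Otimes>\<^sub>M output_dist P K)"
    using P output_dist_prob_space[OF P K] joint_dist_prob_space[OF P K]
    by (auto simp: space_prob_algebra intro!: sets_pair_measure_cong)
qed

lemma section_probability_measurable:
  assumes K: "K \<in> A \<rightarrow>\<^sub>M prob_algebra B" and E: "E \<in> sets (A \<Otimes>\<^sub>M B)"
  shows "(\<lambda>x. measure (K x) (Pair x -` E)) \<in> borel_measurable A"
proof (rule measure_measurable_prob_algebra2[OF _ K])
  have "Sigma (space A) (\<lambda>x. Pair x -` E) = E"
    using sets.sets_into_space[OF E] by (auto simp: space_pair_measure)
  then show "Sigma (space A) (\<lambda>x. Pair x -` E) \<in> sets (A \<Otimes>\<^sub>M B)" using E by simp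
qed

lemma emeasure_joint_dist:
  assumes P: "P \<in> space (prob_algebra A)" and K: "K \<in> A \<rightarrow>\<^sub>M prob_algebra B"
    and E: "E \<in> sets (A \<Otimes>\<^sub>M B)"
  shows "emeasure (joint_dist A B P K) E = (\<integral>\<^sup>+x. emeasure (K x) (Pair x -` E) \<partial>P)"
proof -
  have "emeasure (joint_dist A B P K) E
      = (\<integral>\<^sup>+x. emeasure (distr (K x) (A \<Otimes>\<^sub>M B) (Pair x)) E \<partial>P)"
    unfolding joint_dist_def
    by (rule emeasure_bind_prob_algebra[OF P joint_kernel_measurable[OF K] E])
  also have "\<dots> = (\<integral>\<^sup>+x. emeasure (K x) (Pair x -` E) \<partial>P)"
  proof (rule nn_integral_cong)
    fix x assume "x \<in> space P"
    then have x: "x \<in> space A"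
      using P sets_eq_imp_space_eq[of P A] by (auto simp: space_prob_algebra)
    have mp: "Pair x \<in> K x \<rightarrow>\<^sub>M A \<Otimes>\<^sub>M B"
      using measurable_Pair1'[OF x] kernel_prob_space(2)[OF K x]
      by (simp cong: measurable_cong_sets)
    have "Pair x -` E \<inter> space (K x) = Pair x -` E"
      using sets.sets_into_space[OF E] kernel_prob_space(3)[OF K x]
      by (auto simp: space_pair_measure)
    then show "emeasure (distr (K x) (A \<Otimes>\<^sub>M B) (Pair x)) E = emeasure (K x) (Pair x -` E)"
      using emeasure_distr[OF mp E] by simp
  qed
  finally show ?thesis .
qed

lemma measure_joint_dist:
  assumes P: "P \<in> space (prob_algebra A)" and K: "K \<in> A \<rightarrow>\<^sub>M prob_algebra B"
    and E: "E \<in> sets (A \<Otimes>\<^sub>M B)"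
  shows "integrable P (\<lambda>x. measure (K x) (Pair x -` E))"
    and "measure (joint_dist A B P K) E = (\<integral>x. measure (K x) (Pair x -` E) \<partial>P)"
proof -
  interpret P: prob_space P using P by (simp add: space_prob_algebra)
  have sP: "sets P = sets A" "space P = space A"
    using P sets_eq_imp_space_eq[of P A] by (auto simp: space_prob_algebra)
  have m: "(\<lambda>x. measure (K x) (Pair x -` E)) \<in> borel_measurable P"
    using section_probability_measurable[OF K E] sP(1) by (simp cong: measurable_cong_sets)
  show int: "integrable P (\<lambda>x. measure (K x) (Pair x -` E))"
    using kernel_prob_space(1)[OF K] sP m
    by (intro P.integrable_const_bound[where B=1] AE_I2) (auto intro!: prob_space.prob_le_1)
  have "emeasure (joint_dist A B P K) E = (\<integral>\<^sup>+x. emeasure (K x) (Pair x -` E) \<partial>P)"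
    by (rule emeasure_joint_dist[OF P K E])
  also have "\<dots> = (\<integral>\<^sup>+x. ennreal (measure (K x) (Pair x -` E)) \<partial>P)"
  proof (rule nn_integral_cong)
    fix x assume "x \<in> space P"
    then interpret K: prob_space "K x" using kernel_prob_space(1)[OF K] sP(2) by blast
    show "emeasure (K x) (Pair x -` E) = ennreal (measure (K x) (Pair x -` E))"
      by (rule K.emeasure_eq_measure)
  qed
  also have "\<dots> = ennreal (\<integral>x. measure (K x) (Pair x -` E) \<partial>P)"
    by (rule nn_integral_eq_integral[OF int]) simp
  finally show "measure (joint_dist A B P K) E = (\<integral>x. measure (K x) (Pair x -` E) \<partial>P)"
    by (simp add: measure_def integral_nonneg_AE)
qed

lemma measure_joint_dist_output:
  assumes P: "P \<in> space (prob_algebra A)" and K: "K \<in> A \<rightarrow>\<^sub>M prob_algebra B"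
    and D: "D \<in> sets B"
  shows "measure (joint_dist A B P K) (space A \<times> D) = measure (output_dist P K) D"
proof -
  have sP: "space P = space A"
    using P sets_eq_imp_space_eq[of P A] by (auto simp: space_prob_algebra)
  have "emeasure (joint_dist A B P K) (space A \<times> D)
      = (\<integral>\<^sup>+x. emeasure (K x) (Pair x -` (space A \<times> D)) \<partial>P)"
    using D by (intro emeasure_joint_dist[OF P K]) auto
  also have "\<dots> = (\<integral>\<^sup>+x. emeasure (K x) D \<partial>P)"
    by (intro nn_integral_cong arg_cong2[where f=emeasure]) (auto simp: sP)
  also have "\<dots> = emeasure (output_dist P K) D"
    unfolding output_dist_def by (rule emeasure_bind_prob_algebra[OF P K D, symmetric])
  finally show ?thesis by (simp add: measure_def)
qed

section \<open>Channel codes from disjoint decoding regions\<close>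

lemma disjoint_regions_decoder:
  fixes D :: "nat \<Rightarrow> 'b set"
  assumes m: "m \<ge> 1" and D: "\<And>i. i \<in> {1..m} \<Longrightarrow> D i \<in> sets B"
    and disj: "disjoint_family_on D {1..m}"
  shows "\<exists>d \<in> B \<rightarrow>\<^sub>M count_space {1..m}. \<forall>i\<in>{1..m}. \<forall>y\<in>D i. d y = i"
proof -
  define d where "d y = (if \<exists>i\<in>{1..m}. y \<in> D i then THE i. i \<in> {1..m} \<and> y \<in> D i else 1)" for y
  have uniq: "i = j" if "i \<in> {1..m}" "j \<in> {1..m}" "y \<in> D i" "y \<in> D j" for i j y
    using disj that unfolding disjoint_family_on_def by blast
  have dD: "d y = i" if "i \<in> {1..m}" "y \<in> D i" for i y
  proof -
    have "(THE i. i \<in> {1..m} \<and> y \<in> D i) = i" using that uniq by (intro the_equality) blast+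
    then show ?thesis using that unfolding d_def by auto
  qed
  have d1: "d y = 1" if "\<not> (\<exists>i\<in>{1..m}. y \<in> D i)" for y
    using that unfolding d_def by simp
  have da: "d y = a \<longleftrightarrow> y \<in> D a \<or> (a = 1 \<and> y \<notin> (\<Union>i\<in>{1..m}. D i))" if a: "a \<in> {1..m}" for a y
  proof (cases "\<exists>i\<in>{1..m}. y \<in> D i")
    case True
    then obtain i where i: "i \<in> {1..m}" "y \<in> D i" by blast
    then show ?thesis using dD[OF i] uniq[OF i(1) a i(2)] by auto
  next
    case False
    then show ?thesis using d1[OF False] a by auto
  qed
  have pre: "d -` {a} \<inter> space B
      = (if a = 1 then D a \<union> (space B - (\<Union>i\<in>{1..m}. D i)) else D a)" if a: "a \<in> {1..m}" for a
    using sets.sets_into_space[OF D[OF a]] da[OF a] by auto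
  have "d \<in> B \<rightarrow>\<^sub>M count_space {1..m}"
    unfolding measurable_count_space_eq2[OF finite_atLeastAtMost]
  proof (intro conjI ballI)
    show "d \<in> space B \<rightarrow> {1..m}"
    proof
      fix y show "d y \<in> {1..m}" using dD[of _ y] d1[of y] m by (cases "\<exists>i\<in>{1..m}. y \<in> D i") auto
    qed
    fix a assume a: "a \<in> {1..m}"
    have "(\<Union>i\<in>{1..m}. D i) \<in> sets B" using D by auto
    then show "d -` {a} \<inter> space B \<in> sets B" unfolding pre[OF a] using D[OF a] by auto
  qed
  then show ?thesis using dD by blast
qed

text \<open>
  A decoder is the same thing as a finite disjoint family of decoding regions. The index set is
  arbitrary, because the messages below are words of a source or a subset of the messages of another
  code.
\<close>

lemma channel_code_of_regions:
  assumes K: "K \<in> A \<rightarrow>\<^sub>M prob_algebra B" and I: "finite I" "I \<noteq> {}"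
    and x: "\<And>i. i \<in> I \<Longrightarrow> x i \<in> space A" and D: "\<And>i. i \<in> I \<Longrightarrow> D i \<in> sets B"
    and disj: "disjoint_family_on D I"
    and ge: "\<And>i. i \<in> I \<Longrightarrow> 1 - \<epsilon> \<le> measure (K (x i)) (D i)"
  shows "\<exists>e d. channel_code A B (card I) e d \<and>
    (\<forall>i\<in>{1..card I}. channel_message_error K e d i \<le> \<epsilon>)"
proof -
  obtain h where h: "bij_betw h {1..card I} I" using ex_bij_betw_nat_finite_1[OF I(1)] by blast
  have hI: "h i \<in> I" if "i \<in> {1..card I}" for i using bij_betwE[OF h] that by blast
  have m: "card I \<ge> 1" using I card_gt_0_iff[of I] by linarith
  have "disjoint_family_on (\<lambda>i. D (h i)) {1..card I}"
    unfolding disjoint_family_on_def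
  proof (intro ballI impI)
    fix i j assume ij: "i \<in> {1..card I}" "j \<in> {1..card I}" "i \<noteq> j"
    then have "h i \<noteq> h j" using bij_betw_imp_inj_on[OF h] by (auto dest: inj_onD)
    then show "D (h i) \<inter> D (h j) = {}"
      using disj hI[OF ij(1)] hI[OF ij(2)] unfolding disjoint_family_on_def by blast
  qed
  then have "\<exists>d \<in> B \<rightarrow>\<^sub>M count_space {1..card I}. \<forall>i\<in>{1..card I}. \<forall>y\<in>D (h i). d y = i"
    by (intro disjoint_regions_decoder m D hI)
  then obtain d where d: "d \<in> B \<rightarrow>\<^sub>M count_space {1..card I}"
    and dD: "\<And>i y. i \<in> {1..card I} \<Longrightarrow> y \<in> D (h i) \<Longrightarrow> d y = i"
    by metis
  have "channel_code A B (card I) (\<lambda>i. x (h i)) d"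
    unfolding channel_code_def by (intro conjI m d funcsetI x hI)
  moreover have "channel_message_error K (\<lambda>i. x (h i)) d i \<le> \<epsilon>" if i: "i \<in> {1..card I}" for i
  proof -
    have xA: "x (h i) \<in> space A" by (rule x[OF hI[OF i]])
    interpret K: prob_space "K (x (h i))" by (rule kernel_prob_space[OF K xA])
    have sK: "sets (K (x (h i))) = sets B" "space (K (x (h i))) = space B"
      using kernel_prob_space[OF K xA] by auto
    have Di: "D (h i) \<in> K.events" using D[OF hI[OF i]] sK by simp
    have "channel_message_error K (\<lambda>i. x (h i)) d i
        \<le> measure (K (x (h i))) (space (K (x (h i))) - D (h i))"
      unfolding channel_message_error_def using dD[OF i] Di
      by (intro K.finite_measure_mono) auto
    also have "\<dots> \<le> \<epsilon>" using K.prob_compl[OF Di] ge[OF hI[OF i]] by simp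
    finally show ?thesis .
  qed
  ultimately show ?thesis by blast
qed

lemma message_error_bounds:
  assumes K: "K \<in> A \<rightarrow>\<^sub>M prob_algebra B" and code: "channel_code A B m e d" and i: "i \<in> {1..m}"
  shows "0 \<le> channel_message_error K e d i" "channel_message_error K e d i \<le> 1"
    and "measure (K (e i)) (d -` {i} \<inter> space B) = 1 - channel_message_error K e d i"
    and "d -` {i} \<inter> space B \<in> sets B"
proof -
  have e: "e i \<in> space A" and d: "d \<in> B \<rightarrow>\<^sub>M count_space {1..m}"
    using code i unfolding channel_code_def by auto
  interpret K: prob_space "K (e i)" by (rule kernel_prob_space[OF K e])
  have sK: "sets (K (e i)) = sets B" "space (K (e i)) = space B"
    using kernel_prob_space[OF K e] by auto
  show "0 \<le> channel_message_error K e d i" "channel_message_error K e d i \<le> 1"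
    unfolding channel_message_error_def by (auto simp: measure_nonneg)
  show D: "d -` {i} \<inter> space B \<in> sets B" using measurable_sets[OF d, of "{i}"] i by simp
  have "{y \<in> space (K (e i)). d y \<noteq> i} = space (K (e i)) - (d -` {i} \<inter> space B)"
    by (auto simp: sK)
  then show "measure (K (e i)) (d -` {i} \<inter> space B) = 1 - channel_message_error K e d i"
    unfolding channel_message_error_def using K.prob_compl[of "d -` {i} \<inter> space B"] D sK by simp
qed

text \<open>
  Fewer than half of the messages can have more than twice the average error.
\<close>

lemma expurgated_code:
  assumes K: "K \<in> A \<rightarrow>\<^sub>M prob_algebra B" and code: "channel_code A B m e d"
    and m': "1 \<le> m'" "2 * m' \<le> m"
  shows "\<exists>e' d'. channel_code A B m' e' d' \<and>
    (\<forall>i\<in>{1..m'}. channel_message_error K e' d' i \<le> 2 * channel_avg_error K m e d)"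
proof -
  let ?err = "channel_message_error K e d" and ?a = "channel_avg_error K m e d"
  define Good where "Good = {i\<in>{1..m}. ?err i \<le> 2 * ?a}"
  define Bad where "Bad = {i\<in>{1..m}. 2 * ?a < ?err i}"
  have pos: "0 \<le> ?err i" if "i \<in> {1..m}" for i using message_error_bounds[OF K code that] by simp
  have sum: "(\<Sum>i\<in>{1..m}. ?err i) = real m * ?a" using m' by (simp add: channel_avg_error_def)
  have a0: "0 \<le> ?a" unfolding channel_avg_error_def using pos by (intro mult_nonneg_nonneg sum_nonneg) auto
  have fin: "finite Good" "finite Bad" by (auto simp: Good_def Bad_def)
  have GB: "Good \<union> Bad = {1..m}" "Good \<inter> Bad = {}" by (auto simp: Good_def Bad_def)
  then have card: "card Good + card Bad = m" using card_Un_disjoint[OF fin GB(2)] by simp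
  have "2 * card Bad \<le> m"
  proof (rule ccontr)
    assume big: "\<not> 2 * card Bad \<le> m"
    then have ne: "Bad \<noteq> {}" by auto
    have "real m * ?a \<le> real (2 * card Bad) * ?a" using big a0 by (intro mult_right_mono) auto
    also have "\<dots> = (\<Sum>i\<in>Bad. 2 * ?a)" by simp
    also have "\<dots> < (\<Sum>i\<in>Bad. ?err i)" using ne fin by (intro sum_strict_mono) (auto simp: Bad_def)
    also have "\<dots> \<le> (\<Sum>i\<in>{1..m}. ?err i)" using pos GB by (intro sum_mono2) auto
    finally show False using sum by simp
  qed
  then have "m' \<le> card Good" using card m' by linarith
  then obtain I where I: "I \<subseteq> Good" "card I = m'" "finite I" by (rule obtain_subset_with_card_n)
  have Im: "I \<subseteq> {1..m}" using I(1) by (auto simp: Good_def)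
  have "\<exists>e' d'. channel_code A B (card I) e' d' \<and>
    (\<forall>i\<in>{1..card I}. channel_message_error K e' d' i \<le> 2 * ?a)"
  proof (rule channel_code_of_regions[OF K I(3), where x=e and D="\<lambda>i. d -` {i} \<inter> space B"])
    show "I \<noteq> {}" using I m' by auto
    show "e i \<in> space A" if "i \<in> I" for i using code that Im unfolding channel_code_def by auto
    show "d -` {i} \<inter> space B \<in> sets B" if "i \<in> I" for i
      using message_error_bounds[OF K code] that Im by auto
    show "disjoint_family_on (\<lambda>i. d -` {i} \<inter> space B) I" by (auto simp: disjoint_family_on_def)
    show "1 - 2 * ?a \<le> measure (K (e i)) (d -` {i} \<inter> space B)" if "i \<in> I" for i
      using message_error_bounds(3)[OF K code, of i] that Im I(1) by (auto simp: Good_def)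
  qed
  then show ?thesis using I by simp
qed

section \<open>Joint codes\<close>

text \<open>
  As an expectation over the source, the error probability becomes accessible to Markov's inequality
  and to monotonicity.
\<close>

lemma joint_error_expectation:
  assumes P: "set_pmf P \<subseteq> words n" and K: "K \<in> A \<rightarrow>\<^sub>M prob_algebra B"
    and \<phi>: "\<phi> \<in> words n \<rightarrow> space A"
  shows "integrable (measure_pmf P) (\<lambda>v. \<P>(y in K (\<phi> v). \<psi> y \<noteq> v))"
    and "joint_error P K n \<phi> \<psi> = measure_pmf.expectation P (\<lambda>v. \<P>(y in K (\<phi> v). \<psi> y \<noteq> v))"
proof -
  let ?err = "\<lambda>v. \<P>(y in K (\<phi> v). \<psi> y \<noteq> v)"
  have le1: "?err v \<le> 1" if "v \<in> words n" for v
    using \<phi> that kernel_prob_space(1)[OF K, of "\<phi> v"] by (auto intro!: prob_space.prob_le_1)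
  show int: "integrable (measure_pmf P) ?err"
    using P le1 by (intro measure_pmf.integrable_const_bound[where B=1])
      (auto simp: AE_measure_pmf_iff)
  have "Infinite_Set_Sum.abs_summable_on (pmf P) UNIV" by (rule pmf_abs_summable)
  then have "Infinite_Set_Sum.abs_summable_on (\<lambda>v. pmf P v * ?err v) UNIV"
  proof (rule abs_summable_on_comparison_test)
    fix v
    show "norm (pmf P v * ?err v) \<le> norm (pmf P v)"
      using P le1[of v] by (cases "v \<in> set_pmf P") (auto simp: mult_left_le set_pmf_iff)
  qed
  then have "infsetsum (\<lambda>v. pmf P v * ?err v) UNIV = infsum (\<lambda>v. pmf P v * ?err v) UNIV"
    by (rule infsetsum_infsum)
  also have "\<dots> = infsum (\<lambda>v. pmf P v * ?err v) (words n)"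
    using P by (intro infsum_cong_neutral) (auto simp: pmf_eq_0_set_pmf)
  finally show "joint_error P K n \<phi> \<psi> = measure_pmf.expectation P ?err"
    unfolding joint_error_def pmf_expectation_eq_infsetsum by simp
qed

lemma joint_error_nonneg:
  assumes "set_pmf P \<subseteq> words n" "K \<in> A \<rightarrow>\<^sub>M prob_algebra B" "\<phi> \<in> words n \<rightarrow> space A"
  shows "0 \<le> joint_error P K n \<phi> \<psi>"
  unfolding joint_error_expectation(2)[OF assms] by (intro integral_nonneg_AE) auto

text \<open>
  A word that the source code reproduces is lost only if the channel code confuses its index.
\<close>

lemma two_step_joint_error:
  assumes P: "set_pmf P \<subseteq> words n" and K: "K \<in> A \<rightarrow>\<^sub>M prob_algebra B"
    and src: "source_code n m f g" and code: "channel_code A B m e d"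
    and c: "\<And>i. i \<in> {1..m} \<Longrightarrow> channel_message_error K e d i \<le> c"
  shows "joint_error P K n (e \<circ> f) (g \<circ> d) \<le> source_error P f g + c"
proof -
  have ef: "e \<circ> f \<in> words n \<rightarrow> space A"
    using src code unfolding source_code_def channel_code_def by auto
  let ?err = "\<lambda>v. \<P>(y in K ((e \<circ> f) v). (g \<circ> d) y \<noteq> v)"
  let ?bad = "{v. g (f v) \<noteq> v}"
  have m: "1 \<in> {1..m}" using code by (simp add: channel_code_def)
  have c0: "0 \<le> c" using message_error_bounds(1)[OF K code m] c[OF m] by simp
  have le: "?err v \<le> indicator ?bad v + c" if v: "v \<in> words n" for v
  proof -
    have fv: "f v \<in> {1..m}" using src v unfolding source_code_def by auto
    then have efv: "e (f v) \<in> space A" using code unfolding channel_code_def by auto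
    interpret K: prob_space "K (e (f v))" by (rule kernel_prob_space[OF K efv])
    show ?thesis
    proof (cases "g (f v) = v")
      case True
      have dm: "d \<in> K (e (f v)) \<rightarrow>\<^sub>M count_space {1..m}"
        using code unfolding channel_code_def
          measurable_cong_sets[OF kernel_prob_space(2)[OF K efv] refl] by simp
      have "{y \<in> space (K (e (f v))). d y \<noteq> f v} \<in> sets (K (e (f v)))"
        using dm by measurable
      then have "?err v \<le> channel_message_error K e d (f v)"
        unfolding channel_message_error_def comp_def using True
        by (intro K.finite_measure_mono) auto
      also have "\<dots> \<le> c" by (rule c[OF fv])
      finally show ?thesis using True by simp
    next
      case False
      have "?err v \<le> 1" unfolding comp_def by (rule K.prob_le_1)
      then show ?thesis using False c0 by (simp del: comp_apply)
    qed
  qed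
  have "joint_error P K n (e \<circ> f) (g \<circ> d) = measure_pmf.expectation P ?err"
    by (rule joint_error_expectation(2)[OF P K ef])
  also have "\<dots> \<le> measure_pmf.expectation P (\<lambda>v. indicator ?bad v + c)"
  proof (rule integral_mono_AE)
    show "integrable (measure_pmf P) ?err" by (rule joint_error_expectation(1)[OF P K ef])
    show "integrable (measure_pmf P) (\<lambda>v. indicator ?bad v + c)"
      by (intro Bochner_Integration.integrable_add) (auto simp: measure_pmf.emeasure_finite less_top[symmetric])
    show "AE v in measure_pmf P. ?err v \<le> indicator ?bad v + c"
      using P le by (auto simp: AE_measure_pmf_iff)
  qed
  also have "\<dots> = source_error P f g + c"
    by (subst Bochner_Integration.integral_add)
       (auto simp: source_error_def measure_pmf.emeasure_finite less_top[symmetric])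
  finally show ?thesis .
qed

text \<open>
  The messages of the channel code are the words of \<open>T\<close> that the joint code decodes with error below
  \<open>c\<close>. By Markov's inequality words with larger error have probability at most \<open>\<delta> / 2\<close>, so the
  others in \<open>T\<close> keep probability \<open>\<delta> / 2\<close>; since each of them has probability at most \<open>q\<close>, there are
  at least \<open>\<delta> / (2 q)\<close> of them.
\<close>

lemma channel_code_of_joint_code:
  assumes P: "set_pmf P \<subseteq> words n" and K: "K \<in> block A n \<rightarrow>\<^sub>M prob_algebra (block B n)"
    and code: "joint_code A B n \<phi> \<psi>"
    and q: "q > 0" "\<And>v. v \<in> T \<Longrightarrow> pmf P v \<le> q"
    and \<delta>: "\<delta> > 0" "\<delta> \<le> measure_pmf.prob P T"
    and c: "c > 0" "joint_error P K n \<phi> \<psi> \<le> c * \<delta> / 2"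
  shows "\<exists>e d. channel_code (block A n) (block B n) (nat \<lceil>\<delta> / (2 * q)\<rceil>) e d \<and>
    (\<forall>i\<in>{1..nat \<lceil>\<delta> / (2 * q)\<rceil>}. channel_message_error K e d i \<le> c)"
proof -
  let ?err = "\<lambda>v. \<P>(y in K (\<phi> v). \<psi> y \<noteq> v)" and ?m = "nat \<lceil>\<delta> / (2 * q)\<rceil>"
  have \<phi>: "\<phi> \<in> words n \<rightarrow> space (block A n)"
    and \<psi>: "\<psi> \<in> block B n \<rightarrow>\<^sub>M count_space (words n)"
    using code unfolding joint_code_def by auto
  define S where "S = {v \<in> T \<inter> words n. ?err v < c}"
  have "measure_pmf.prob P {v \<in> space (measure_pmf P). ?err v \<ge> c}
      \<le> measure_pmf.expectation P ?err / c"
    by (intro integral_Markov_inequality_measure[where A=UNIV] joint_error_expectation(1)[OF P K \<phi>])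
       (auto simp: c(1))
  also have "\<dots> \<le> \<delta> / 2"
    using c joint_error_expectation(2)[OF P K \<phi>, of \<psi>] by (simp add: field_simps)
  finally have bad: "measure_pmf.prob P {v. ?err v \<ge> c} \<le> \<delta> / 2" by simp
  have "measure_pmf.prob P T \<le> measure_pmf.prob P (S \<union> {v. ?err v \<ge> c})"
    using P by (intro measure_pmf.finite_measure_mono_AE) (auto simp: S_def AE_measure_pmf_iff)
  also have "\<dots> \<le> measure_pmf.prob P S + measure_pmf.prob P {v. ?err v \<ge> c}"
    by (rule measure_Un_le) auto
  finally have S: "\<delta> / 2 \<le> measure_pmf.prob P S" using bad \<delta> by linarith
  have "\<exists>I. finite I \<and> card I = ?m \<and> I \<subseteq> S"
  proof (cases "finite S")
    case True
    have "\<delta> / 2 \<le> (\<Sum>v\<in>S. pmf P v)" using S True by (simp add: measure_measure_pmf_finite)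
    also have "\<dots> \<le> (\<Sum>v\<in>S. q)" using q by (intro sum_mono) (auto simp: S_def)
    finally have "\<delta> / (2 * q) \<le> real (card S)" using q by (simp add: field_simps)
    then have "?m \<le> card S" by (simp add: ceiling_le_iff nat_le_iff)
    then show ?thesis by (metis obtain_subset_with_card_n)
  next
    case False
    then show ?thesis by (metis infinite_arbitrarily_large)
  qed
  then obtain I where I: "finite I" "card I = ?m" "I \<subseteq> S" by blast
  have mpos: "?m > 0" using \<delta> q by simp
  have "\<exists>e d. channel_code (block A n) (block B n) (card I) e d \<and>
    (\<forall>i\<in>{1..card I}. channel_message_error K e d i \<le> c)"
  proof (rule channel_code_of_regions[OF K I(1), where x=\<phi> and D="\<lambda>v. \<psi> -` {v} \<inter> space (block B n)"])
    show "I \<noteq> {}" using I(2) mpos by auto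
    fix v assume v: "v \<in> I"
    then have vw: "v \<in> words n" and ev: "?err v < c" using I(3) by (auto simp: S_def)
    show xA: "\<phi> v \<in> space (block A n)" using \<phi> vw by auto
    show D: "\<psi> -` {v} \<inter> space (block B n) \<in> sets (block B n)"
      using measurable_sets[OF \<psi>, of "{v}"] vw by simp
    interpret K: prob_space "K (\<phi> v)" by (rule kernel_prob_space[OF K xA])
    have sK: "sets (K (\<phi> v)) = sets (block B n)" "space (K (\<phi> v)) = space (block B n)"
      using kernel_prob_space[OF K xA] by auto
    have "{y \<in> space (K (\<phi> v)). \<psi> y \<noteq> v}
        = space (K (\<phi> v)) - (\<psi> -` {v} \<inter> space (block B n))" unfolding sK by auto
    then show "1 - c \<le> measure (K (\<phi> v)) (\<psi> -` {v} \<inter> space (block B n))"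
      using K.prob_compl[of "\<psi> -` {v} \<inter> space (block B n)"] D sK ev by simp
  next
    show "disjoint_family_on (\<lambda>v. \<psi> -` {v} \<inter> space (block B n)) I"
      by (auto simp: disjoint_family_on_def)
  qed
  then show ?thesis using I by simp
qed

section \<open>Feinstein's greedy construction\<close>

text \<open>
  Where the density is at least \<open>\<theta>\<close>, the joint law is at least \<open>\<theta>\<close> times the product law. On the
  inputs \<open>x\<close> whose section of \<open>G\<close> has output probability above \<open>1 / \<theta>\<close>, this would force a
  conditional probability above \<open>1\<close>; so such inputs form a null set.
\<close>

lemma output_probability_of_likely_section:
  assumes P: "P \<in> space (prob_algebra A)" and K: "K \<in> A \<rightarrow>\<^sub>M prob_algebra B"
    and \<theta>: "\<theta> > 0" and G: "G \<in> sets (A \<Otimes>\<^sub>M B)"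
    and ge: "\<And>z. z \<in> G \<Longrightarrow>
      ennreal \<theta> \<le> ext_RN_deriv (P \<Otimes>\<^sub>M output_dist P K) (joint_dist A B P K) z"
  shows "AE x in P. measure (output_dist P K) (Pair x -` G) \<le> 1 / \<theta>"
proof -
  let ?Q = "output_dist P K" and ?J = "joint_dist A B P K"
  interpret P: prob_space P using P by (simp add: space_prob_algebra)
  interpret Q: prob_space ?Q by (rule output_dist_prob_space[OF P K])
  interpret J: prob_space ?J by (rule joint_dist_prob_space[OF P K])
  have sP: "sets P = sets A" "space P = space A"
    using P sets_eq_imp_space_eq[of P A] by (auto simp: space_prob_algebra)
  have sQ: "sets ?Q = sets B" "space ?Q = space B" using output_dist_prob_space[OF P K] by auto
  have sPQ: "sets (P \<Otimes>\<^sub>M ?Q) = sets (A \<Otimes>\<^sub>M B)" using sP sQ by (intro sets_pair_measure_cong)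
  have G': "G \<in> sets (P \<Otimes>\<^sub>M ?Q)" using G sPQ by simp
  have secm: "(\<lambda>x. measure ?Q (Pair x -` E)) \<in> borel_measurable P"
    if "E \<in> sets (P \<Otimes>\<^sub>M ?Q)" for E
    using Q.measurable_emeasure_Pair[OF that] unfolding measure_def by measurable
  define F where "F = {x \<in> space P. 1 / \<theta> < measure ?Q (Pair x -` G)}"
  have F: "F \<in> sets P" unfolding F_def using secm[OF G'] by measurable
  define H where "H = G \<inter> (F \<times> space ?Q)"
  have H: "H \<in> sets (P \<Otimes>\<^sub>M ?Q)" unfolding H_def using G' F by auto
  have HA: "H \<in> sets (A \<Otimes>\<^sub>M B)" using H sPQ by simp
  have sec: "Pair x -` H = (if x \<in> F then Pair x -` G else {})" for x
    using sets.sets_into_space[OF G'] by (auto simp: H_def space_pair_measure)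
  have int: "integrable P (\<lambda>x. measure ?Q (Pair x -` H))"
    by (rule P.integrable_const_bound[where B=1]) (use secm[OF H] in auto)
  have "emeasure (P \<Otimes>\<^sub>M ?Q) H = (\<integral>\<^sup>+x. ennreal (measure ?Q (Pair x -` H)) \<partial>P)"
    using Q.emeasure_pair_measure_alt[OF H] by (simp add: Q.emeasure_eq_measure)
  also have "\<dots> = ennreal (\<integral>x. measure ?Q (Pair x -` H) \<partial>P)"
    by (rule nn_integral_eq_integral[OF int]) simp
  finally have PQ: "emeasure (P \<Otimes>\<^sub>M ?Q) H = ennreal (\<integral>x. measure ?Q (Pair x -` H) \<partial>P)" .
  have "ennreal \<theta> * emeasure (P \<Otimes>\<^sub>M ?Q) H \<le> emeasure ?J H"
    using ge by (intro emeasure_ge_of_density_ge[OF input_output_product_finite(1)[OF P K]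
          J.finite_measure_axioms input_output_product_finite(2)[OF P K] H]) (auto simp: H_def)
  then have "\<theta> * (\<integral>x. measure ?Q (Pair x -` H) \<partial>P) \<le> measure ?J H"
    using \<theta> unfolding PQ J.emeasure_eq_measure
    by (simp add: ennreal_mult'[symmetric] integral_nonneg_AE)
  also have "\<dots> = (\<integral>x. measure (K x) (Pair x -` H) \<partial>P)" by (rule measure_joint_dist(2)[OF P K HA])
  also have "\<dots> \<le> (\<integral>x. indicator F x \<partial>P)"
  proof (rule integral_mono[OF measure_joint_dist(1)[OF P K HA]])
    show "integrable P (indicator F :: _ \<Rightarrow> real)" using F by (simp add: P.emeasure_eq_measure)
    fix x assume "x \<in> space P"
    then have "prob_space (K x)" using kernel_prob_space(1)[OF K] sP(2) by auto
    then show "measure (K x) (Pair x -` H) \<le> indicator F x"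
      by (simp add: sec prob_space.prob_le_1 split: split_indicator)
  qed
  finally have le: "\<theta> * (\<integral>x. measure ?Q (Pair x -` H) \<partial>P) \<le> (\<integral>x. indicator F x \<partial>P)" .
  (* h is positive exactly on F, but its integral is not positive by the previous inequality. *)
  define h where "h x = \<theta> * measure ?Q (Pair x -` H) - indicator F x" for x
  have inth: "integrable P h"
    unfolding h_def using int F by (intro Bochner_Integration.integrable_diff) (auto simp: P.emeasure_eq_measure)
  have h: "0 < h x" if "x \<in> F" for x
    using that \<theta> by (simp add: h_def sec F_def field_simps)
  have h0: "h x = 0" if "x \<notin> F" for x using that by (simp add: h_def sec)
  have hnn: "0 \<le> h x" for x using h[of x] h0[of x] by (cases "x \<in> F") auto
  have "(\<integral>x. h x \<partial>P) \<le> 0"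
    using le int F unfolding h_def
    by (subst Bochner_Integration.integral_diff) (auto simp: P.emeasure_eq_measure)
  then have "(\<integral>x. h x \<partial>P) = 0" using hnn by (intro antisym integral_nonneg_AE) auto
  then have "AE x in P. h x = 0" using integral_nonneg_eq_0_iff_AE[OF inth] hnn by auto
  then show ?thesis using AE_space
  proof eventually_elim
    case (elim x)
    then have "x \<notin> F" using h[of x] by auto
    then show ?case using elim by (auto simp: F_def)
  qed
qed

text \<open>
  Codewords are chosen greedily, each with the part of its section of \<open>G\<close> that no earlier codeword
  has used as its decoding region. If almost every remaining section had conditional probability below
  \<open>1 - \<epsilon>\<close>, then \<open>G\<close> would have joint probability at most \<open>1 - \<epsilon>\<close> plus the output probability of the
  used part, which is at most \<open>q\<close> for each earlier codeword.
\<close>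

lemma feinstein_regions:
  assumes P: "P \<in> space (prob_algebra A)" and K: "K \<in> A \<rightarrow>\<^sub>M prob_algebra B"
    and G: "G \<in> sets (A \<Otimes>\<^sub>M B)" and q: "q \<ge> 0"
    and sec: "AE x in P. measure (output_dist P K) (Pair x -` G) \<le> q"
  shows "1 - \<epsilon> + real m * q < measure (joint_dist A B P K) G \<Longrightarrow>
    \<exists>x D. (\<forall>i<m. x i \<in> space A \<and> D i \<in> sets B \<and> measure (output_dist P K) (D i) \<le> q \<and>
        1 - \<epsilon> \<le> measure (K (x i)) (D i)) \<and> disjoint_family_on D {..<m}"
proof (induction m)
  case 0
  then show ?case by (simp add: disjoint_family_on_def)
next
  case (Suc m)
  let ?Q = "output_dist P K" and ?J = "joint_dist A B P K"
  interpret P: prob_space P using P by (simp add: space_prob_algebra)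
  interpret Q: prob_space ?Q by (rule output_dist_prob_space[OF P K])
  interpret J: prob_space ?J by (rule joint_dist_prob_space[OF P K])
  have sP: "space P = space A"
    using P sets_eq_imp_space_eq[of P A] by (auto simp: space_prob_algebra)
  have sQ: "sets ?Q = sets B" using output_dist_prob_space[OF P K] by auto
  have sJ: "sets ?J = sets (A \<Otimes>\<^sub>M B)" using joint_dist_prob_space[OF P K] by auto
  have "1 - \<epsilon> + real m * q < measure ?J G" using Suc.prems q by (simp add: field_simps)
  then obtain x D where xD: "\<And>i. i < m \<Longrightarrow> x i \<in> space A \<and> D i \<in> sets B \<and> measure ?Q (D i) \<le> q \<and>
      1 - \<epsilon> \<le> measure (K (x i)) (D i)" and disj: "disjoint_family_on D {..<m}"
    using Suc.IH by blast
  define U where "U = (\<Union>i<m. D i)"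
  have U: "U \<in> sets B" unfolding U_def using xD by auto
  have "measure ?Q U \<le> (\<Sum>i<m. measure ?Q (D i))"
    unfolding U_def using xD sQ by (intro Q.finite_measure_subadditive_finite) auto
  also have "\<dots> \<le> (\<Sum>i<m. q)" using xD by (intro sum_mono) auto
  finally have QU: "measure ?Q U \<le> real m * q" by simp
  (* The part of G that is still free for decoding a new codeword. *)
  define E where "E = G - space A \<times> U"
  have E: "E \<in> sets (A \<Otimes>\<^sub>M B)" unfolding E_def using G U by auto
  have "\<exists>a\<in>space A. measure ?Q (Pair a -` G) \<le> q \<and> 1 - \<epsilon> \<le> measure (K a) (Pair a -` E)"
  proof (rule ccontr)
    assume neg: "\<not> ?thesis"
    have "AE a in P. measure (K a) (Pair a -` E) \<le> 1 - \<epsilon>"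
      using sec AE_space
    proof eventually_elim
      case (elim a)
      then show ?case using neg by (simp add: sP) (metis linear)
    qed
    then have JE: "measure ?J E \<le> 1 - \<epsilon>"
      unfolding measure_joint_dist(2)[OF P K E]
      by (intro P.integral_le_const measure_joint_dist(1)[OF P K E])
    have "measure ?J G \<le> measure ?J (E \<union> space A \<times> U)"
      using E U G sJ by (intro J.finite_measure_mono) (auto simp: E_def)
    also have "\<dots> \<le> measure ?J E + measure ?J (space A \<times> U)"
      using E U sJ by (intro measure_Un_le) auto
    also have "measure ?J (space A \<times> U) = measure ?Q U"
      by (rule measure_joint_dist_output[OF P K U])
    finally show False using JE QU Suc.prems q by (simp add: field_simps)
  qed
  then obtain a where a: "a \<in> space A" "measure ?Q (Pair a -` G) \<le> q"
    "1 - \<epsilon> \<le> measure (K a) (Pair a -` E)" by blast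
  define x' where "x' i = (if i = m then a else x i)" for i
  define D' where "D' i = (if i = m then Pair a -` E else D i)" for i
  have secE: "Pair a -` E \<in> sets B" by (rule sets_Pair1[OF E])
  have secG: "Pair a -` G \<in> sets B" by (rule sets_Pair1[OF G])
  have "measure ?Q (Pair a -` E) \<le> measure ?Q (Pair a -` G)"
    using secG sQ by (intro Q.finite_measure_mono) (auto simp: E_def)
  then have "\<forall>i<Suc m. x' i \<in> space A \<and> D' i \<in> sets B \<and> measure ?Q (D' i) \<le> q \<and>
      1 - \<epsilon> \<le> measure (K (x' i)) (D' i)"
    using xD a secE by (auto simp: x'_def D'_def less_Suc_eq)
  moreover have dj: "D i \<inter> Pair a -` E = {}" if "i < m" for i
    using that a(1) by (auto simp: E_def U_def)
  have "disjoint_family_on D' {..<Suc m}"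
    unfolding disjoint_family_on_def
  proof (intro ballI impI)
    fix i j assume "i \<in> {..<Suc m}" "j \<in> {..<Suc m}" "i \<noteq> j"
    then consider "i < m" "j < m" | "i = m" "j < m" | "i < m" "j = m" by fastforce
    then show "D' i \<inter> D' j = {}"
    proof cases
      case 1
      then show ?thesis using disj \<open>i \<noteq> j\<close> by (simp add: D'_def disjoint_family_on_def)
    qed (use dj in \<open>auto simp: D'_def\<close>)
  qed
  ultimately show ?case by blast
qed

text \<open>
  With the pairs of density at least \<open>\<theta>\<close> as \<open>G\<close>, the greedy construction runs with \<open>q = 1 / \<theta>\<close>: every
  message adds \<open>1 / \<theta>\<close> to the probability that a pair lies outside \<open>G\<close>.
\<close>

lemma feinstein_code:
  assumes P: "P \<in> space (prob_algebra A)" and K: "K \<in> A \<rightarrow>\<^sub>M prob_algebra B"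
    and \<theta>: "\<theta> > 0" and m: "m \<ge> 1"
    and \<epsilon>: "measure (joint_dist A B P K) {z \<in> space (joint_dist A B P K).
      ext_RN_deriv (P \<Otimes>\<^sub>M output_dist P K) (joint_dist A B P K) z < ennreal \<theta>} + real m / \<theta> < \<epsilon>"
  shows "\<exists>e d. channel_code A B m e d \<and> (\<forall>i\<in>{1..m}. channel_message_error K e d i \<le> \<epsilon>)"
proof -
  let ?J = "joint_dist A B P K"
  let ?f = "ext_RN_deriv (P \<Otimes>\<^sub>M output_dist P K) ?J"
  interpret J: prob_space ?J by (rule joint_dist_prob_space[OF P K])
  have f: "?f \<in> borel_measurable ?J"
    using ext_RN_deriv_measurable[OF J.finite_measure_axioms input_output_product_finite(2)[OF P K]]
    unfolding measurable_cong_sets[OF input_output_product_finite(2)[OF P K] refl] .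
  have L: "{z \<in> space ?J. ?f z < ennreal \<theta>} \<in> sets ?J" using f by measurable
  define G where "G = space ?J - {z \<in> space ?J. ?f z < ennreal \<theta>}"
  have G: "G \<in> sets (A \<Otimes>\<^sub>M B)"
    using sets.compl_sets[OF L] joint_dist_prob_space(2)[OF P K] unfolding G_def by simp
  have ge: "ennreal \<theta> \<le> ?f z" if "z \<in> G" for z using that by (auto simp: G_def)
  have "1 - \<epsilon> + real m * (1 / \<theta>) < measure ?J G"
    unfolding G_def J.prob_compl[OF L] using \<epsilon> by simp
  then obtain x D where xD: "\<And>i. i < m \<Longrightarrow> x i \<in> space A \<and> D i \<in> sets B \<and>
      1 - \<epsilon> \<le> measure (K (x i)) (D i)" and disj: "disjoint_family_on D {..<m}"
    using feinstein_regions[OF P K G _ output_probability_of_likely_section[OF P K \<theta> G ge], of \<epsilon> m] \<theta>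
    by auto
  have "{..<m} \<noteq> {}" using m by (simp add: lessThan_empty_iff)
  from channel_code_of_regions[OF K finite_lessThan this _ _ disj, of x \<epsilon>] xD show ?thesis by simp
qed

section \<open>The information density of a uniformly distributed codeword\<close>

text \<open>
  This is the change of measure behind converse bounds, as in the Neyman--Pearson lemma: on \<open>E\<close> a
  small density allows replacing the joint law by \<open>\<theta>\<close> times the product law.
\<close>

lemma measure_density_less_le:
  assumes P: "P \<in> space (prob_algebra A)" and K: "K \<in> A \<rightarrow>\<^sub>M prob_algebra B"
    and \<theta>: "\<theta> \<ge> 0" and E: "E \<in> sets (A \<Otimes>\<^sub>M B)"
  shows "measure (joint_dist A B P K) {z \<in> space (joint_dist A B P K).
      ext_RN_deriv (P \<Otimes>\<^sub>M output_dist P K) (joint_dist A B P K) z < ennreal \<theta>}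
    \<le> measure (joint_dist A B P K) (space (joint_dist A B P K) - E)
      + \<theta> * measure (P \<Otimes>\<^sub>M output_dist P K) E"
proof -
  let ?J = "joint_dist A B P K" and ?M = "P \<Otimes>\<^sub>M output_dist P K"
  let ?f = "ext_RN_deriv ?M ?J"
  interpret J: prob_space ?J by (rule joint_dist_prob_space[OF P K])
  interpret M: finite_measure ?M by (rule input_output_product_finite[OF P K])
  note JM = input_output_product_finite(2)[OF P K]
  have f: "?f \<in> borel_measurable ?J"
    using ext_RN_deriv_measurable[OF J.finite_measure_axioms JM]
    unfolding measurable_cong_sets[OF JM refl] .
  have EJ: "E \<in> sets ?J" and EM: "E \<in> sets ?M"
    using E JM joint_dist_prob_space(2)[OF P K] by auto
  let ?L = "{z\<in>E. ?f z < ennreal \<theta>}"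
  have "?L = E \<inter> {z \<in> space ?J. ?f z < ennreal \<theta>}" using sets.sets_into_space[OF EJ] by auto
  moreover have "{z \<in> space ?J. ?f z < ennreal \<theta>} \<in> sets ?J" using f by measurable
  ultimately have L: "?L \<in> sets ?J" using EJ by auto
  have "emeasure ?J ?L \<le> ennreal \<theta> * emeasure ?M E"
    by (rule emeasure_le_of_density_less[OF M.finite_measure_axioms J.finite_measure_axioms JM EM])
  then have le: "measure ?J ?L \<le> \<theta> * measure ?M E"
    using \<theta> by (simp add: J.emeasure_eq_measure M.emeasure_eq_measure ennreal_mult'[symmetric])
  have "measure ?J {z \<in> space ?J. ?f z < ennreal \<theta>} \<le> measure ?J ((space ?J - E) \<union> ?L)"
    using EJ L by (intro J.finite_measure_mono) auto
  also have "\<dots> \<le> measure ?J (space ?J - E) + measure ?J ?L"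
    using EJ L by (intro measure_Un_le) auto
  finally show ?thesis using le by simp
qed

lemma uniform_codeword_law:
  assumes code: "channel_code A B m e d"
  defines "P \<equiv> distr (uniform_count_measure {1..m}) A e"
  shows "P \<in> space (prob_algebra A)"
    and "F \<in> sets A \<Longrightarrow> measure P F = card {i\<in>{1..m}. e i \<in> F} / m"
    and "\<lbrakk>h \<in> borel_measurable A; \<And>i. i \<in> {1..m} \<Longrightarrow> h (e i) \<le> (c::real); integrable P h\<rbrakk>
      \<Longrightarrow> (\<integral>x. h x \<partial>P) \<le> c"
proof -
  let ?U = "uniform_count_measure {1..m}"
  interpret U: prob_space ?U
    using code by (intro prob_space_uniform_count_measure) (auto simp: channel_code_def)
  have e: "e \<in> ?U \<rightarrow>\<^sub>M A"
    using code by (auto simp: channel_code_def measurable_def space_uniform_count_measure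
        sets_uniform_count_measure)
  show "P \<in> space (prob_algebra A)"
    unfolding P_def using U.prob_space_distr[OF e] by (simp add: space_prob_algebra)
  show "measure P F = card {i\<in>{1..m}. e i \<in> F} / m" if "F \<in> sets A"
  proof -
    have "measure P F = measure ?U (e -` F \<inter> space ?U)"
      unfolding P_def by (rule measure_distr[OF e that])
    also have "e -` F \<inter> space ?U = {i\<in>{1..m}. e i \<in> F}"
      by (auto simp: space_uniform_count_measure)
    also have "measure ?U \<dots> = card {i\<in>{1..m}. e i \<in> F} / card {1..m}"
      by (rule measure_uniform_count_measure) auto
    finally show ?thesis by simp
  qed
  show "(\<integral>x. h x \<partial>P) \<le> c"
    if h: "h \<in> borel_measurable A" "\<And>i. i \<in> {1..m} \<Longrightarrow> h (e i) \<le> c" "integrable P h"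
  proof -
    have "(\<integral>x. h x \<partial>P) = (\<integral>i. h (e i) \<partial>?U)" unfolding P_def by (rule integral_distr[OF e h(1)])
    also have "\<dots> \<le> c"
    proof (rule U.integral_le_const)
      show "integrable ?U (\<lambda>i. h (e i))"
        using h(3) unfolding P_def by (rule integrable_distr[OF e])
      show "AE i in ?U. h (e i) \<le> c"
        using h(2) by (intro AE_I2) (simp add: space_uniform_count_measure)
    qed
    finally show ?thesis .
  qed
qed

text \<open>
  Let \<open>E\<close> be the event that the output lies in the decoding region of the input. Under the joint law
  it fails with probability at most \<open>\<epsilon>\<close>. Under the product law input and output are independent, so
  the output guesses the input with probability at most \<open>1 / m\<close>. As singletons need not be
  measurable, the codeword \<open>e i\<close> is replaced by the set \<open>F i\<close> of inputs that reach the \<open>i\<close>-th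
  decoding region with probability above \<open>1 / 2\<close>. These sets are disjoint, because no input can reach
  two disjoint regions with probability above \<open>1 / 2\<close> each, and \<open>\<epsilon> < 1 / 2\<close> puts \<open>e i\<close> into \<open>F i\<close>.
\<close>

lemma uniform_codeword_density:
  assumes K: "K \<in> A \<rightarrow>\<^sub>M prob_algebra B" and code: "channel_code A B m e d"
    and err: "\<And>i. i \<in> {1..m} \<Longrightarrow> channel_message_error K e d i \<le> \<epsilon>" and \<epsilon>: "\<epsilon> < 1 / 2"
    and \<theta>: "\<theta> \<ge> 0"
  defines "P \<equiv> distr (uniform_count_measure {1..m}) A e"
  shows "measure (joint_dist A B P K) {z \<in> space (joint_dist A B P K).
      ext_RN_deriv (P \<Otimes>\<^sub>M output_dist P K) (joint_dist A B P K) z < ennreal \<theta>} \<le> \<epsilon> + \<theta> / m"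
proof -
  let ?Q = "output_dist P K" and ?J = "joint_dist A B P K"
  have P: "P \<in> space (prob_algebra A)" unfolding P_def by (rule uniform_codeword_law(1)[OF code])
  interpret P: prob_space P using P by (simp add: space_prob_algebra)
  interpret Q: prob_space ?Q by (rule output_dist_prob_space[OF P K])
  interpret J: prob_space ?J by (rule joint_dist_prob_space[OF P K])
  interpret M: finite_measure "P \<Otimes>\<^sub>M ?Q" by (rule input_output_product_finite[OF P K])
  have sP: "sets P = sets A" unfolding P_def by simp
  have sQ: "sets ?Q = sets B" using output_dist_prob_space[OF P K] by auto
  have sJ: "sets ?J = sets (A \<Otimes>\<^sub>M B)" "space ?J = space (A \<Otimes>\<^sub>M B)"
    using joint_dist_prob_space[OF P K] by auto
  have m: "m \<ge> 1" using code by (simp add: channel_code_def)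
  define D where "D i = d -` {i} \<inter> space B" for i
  define F where "F i = {x \<in> space A. 1 / 2 < measure (K x) (D i)}" for i
  have D: "D i \<in> sets B" if "i \<in> {1..m}" for i
    unfolding D_def by (rule message_error_bounds(4)[OF K code that])
  have KD: "1 - \<epsilon> \<le> measure (K (e i)) (D i)" if "i \<in> {1..m}" for i
    unfolding D_def message_error_bounds(3)[OF K code that] using err[OF that] by simp
  have F: "F i \<in> sets A" if "i \<in> {1..m}" for i
  proof -
    have "(\<lambda>x. measure (K x) (D i)) \<in> borel_measurable A"
      using measurable_compose[OF K measurable_measure_prob_algebra[OF D[OF that]]] by simp
    then show ?thesis unfolding F_def by measurable
  qed
  have eF: "e i \<in> F i" if "i \<in> {1..m}" for i
    using code that KD[OF that] \<epsilon> by (auto simp: F_def channel_code_def)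
  have Fdisj: "i = j" if "i \<in> {1..m}" "j \<in> {1..m}" "x \<in> F i" "x \<in> F j" for i j x
  proof (rule ccontr)
    assume "i \<noteq> j"
    then have disj: "D i \<inter> D j = {}" by (auto simp: D_def)
    have x: "x \<in> space A" using that by (simp add: F_def)
    interpret K: prob_space "K x" by (rule kernel_prob_space[OF K x])
    have "measure (K x) (D i \<union> D j) = measure (K x) (D i) + measure (K x) (D j)"
      using D that kernel_prob_space(2)[OF K x] disj by (intro K.finite_measure_Union) auto
    then show False using that K.prob_le_1[of "D i \<union> D j"] by (simp add: F_def)
  qed
  define E where "E = (\<Union>i\<in>{1..m}. F i \<times> D i)"
  have E: "E \<in> sets (A \<Otimes>\<^sub>M B)" unfolding E_def using F D by auto
  have PF: "measure P (F i) = 1 / m" if i: "i \<in> {1..m}" for i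
  proof -
    have "{j\<in>{1..m}. e j \<in> F i} = {i}" using eF Fdisj i by blast
    then show ?thesis unfolding P_def uniform_codeword_law(2)[OF code F[OF i]] by simp
  qed
  have "measure (P \<Otimes>\<^sub>M ?Q) E \<le> (\<Sum>i\<in>{1..m}. measure (P \<Otimes>\<^sub>M ?Q) (F i \<times> D i))"
    unfolding E_def using F D sP sQ by (intro M.finite_measure_subadditive_finite) auto
  also have "\<dots> = (\<Sum>i\<in>{1..m}. measure P (F i) * measure ?Q (D i))"
    using F D sP sQ
    by (intro sum.cong refl) (simp add: measure_def Q.emeasure_pair_measure_Times enn2real_mult)
  also have "\<dots> = 1 / m * (\<Sum>i\<in>{1..m}. measure ?Q (D i))"
    using PF by (simp add: sum_distrib_left)
  also have "(\<Sum>i\<in>{1..m}. measure ?Q (D i)) = measure ?Q (\<Union>i\<in>{1..m}. D i)"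
    using D sQ by (intro Q.finite_measure_finite_Union[symmetric])
      (auto simp: disjoint_family_on_def D_def)
  also have "1 / m * \<dots> \<le> 1 / m * 1" by (intro mult_left_mono Q.prob_le_1) auto
  finally have ME: "measure (P \<Otimes>\<^sub>M ?Q) E \<le> 1 / m" by simp
  let ?C = "space ?J - E"
  have C: "?C \<in> sets (A \<Otimes>\<^sub>M B)" using E sJ by auto
  have "measure ?J ?C = (\<integral>x. measure (K x) (Pair x -` ?C) \<partial>P)" by (rule measure_joint_dist(2)[OF P K C])
  also have "\<dots> \<le> \<epsilon>"
  proof (rule uniform_codeword_law(3)[OF code, folded P_def])
    show "(\<lambda>x. measure (K x) (Pair x -` ?C)) \<in> borel_measurable A"
      by (rule section_probability_measurable[OF K C])
    show "integrable P (\<lambda>x. measure (K x) (Pair x -` ?C))" by (rule measure_joint_dist(1)[OF P K C])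
    fix i assume i: "i \<in> {1..m}"
    have x: "e i \<in> space A" using eF[OF i] by (simp add: F_def)
    interpret K: prob_space "K (e i)" by (rule kernel_prob_space[OF K x])
    have Di: "D i \<in> K.events" using D[OF i] kernel_prob_space(2)[OF K x] by simp
    have "measure (K (e i)) (Pair (e i) -` ?C) \<le> measure (K (e i)) (space (K (e i)) - D i)"
      using Di sets.compl_sets[OF Di] eF[OF i] i kernel_prob_space(3)[OF K x]
      by (intro K.finite_measure_mono) (auto simp: E_def sJ space_pair_measure)
    also have "\<dots> \<le> \<epsilon>" using K.prob_compl[OF Di] KD[OF i] by simp
    finally show "measure (K (e i)) (Pair (e i) -` ?C) \<le> \<epsilon>" .
  qed
  finally have "measure ?J ?C \<le> \<epsilon>" .
  moreover have "\<theta> * measure (P \<Otimes>\<^sub>M ?Q) E \<le> \<theta> / m" using mult_left_mono[OF ME \<theta>] by simp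
  ultimately show ?thesis using measure_density_less_le[OF P K \<theta> E] by linarith
qed

section \<open>Achievable rates\<close>

lemma liminf_log_rate:
  assumes a: "a > 0" and ev: "\<forall>\<^sub>F n in sequentially. a * exp (real n * R) \<le> real (M n)"
  shows "ereal R \<le> liminf (\<lambda>n. ereal (1 / real n * ln (real (M n))))"
proof -
  have "(\<lambda>n. R + ln a / real n) \<longlonglongrightarrow> R + 0"
    by (intro tendsto_add tendsto_const lim_const_over_n)
  then have "(\<lambda>n. ereal (R + ln a / real n)) \<longlonglongrightarrow> ereal R" by simp
  then have "ereal R = liminf (\<lambda>n. ereal (R + ln a / real n))"
    by (intro lim_imp_Liminf[symmetric]) auto
  also have "\<dots> \<le> liminf (\<lambda>n. ereal (1 / real n * ln (real (M n))))"
  proof (rule Liminf_mono)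
    show "\<forall>\<^sub>F n in sequentially. ereal (R + ln a / real n) \<le> ereal (1 / real n * ln (real (M n)))"
      using ev eventually_ge_at_top[of 1]
    proof eventually_elim
      case (elim n)
      have "ln a + real n * R = ln (a * exp (real n * R))" using a by (simp add: ln_mult)
      also have "\<dots> \<le> ln (real (M n))"
      proof -
        have "0 < a * exp (real n * R)" using a by simp
        then show ?thesis using elim(1) by (intro ln_mono) auto
      qed
      finally have "(ln a + real n * R) / real n \<le> ln (real (M n)) / real n"
        by (rule divide_right_mono) simp
      then show ?case using elim(2) by (simp add: add_divide_distrib)
    qed
  qed
  finally show ?thesis .
qed

lemma trivial_channel_code:
  assumes K: "K \<in> A \<rightarrow>\<^sub>M prob_algebra B" and ne: "space A \<noteq> {}"
  shows "\<exists>e d. channel_code A B 1 e d \<and> (\<forall>i\<in>{1..1}. channel_message_error K e d i \<le> 0)"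
proof -
  obtain a where a: "a \<in> space A" using ne by blast
  have "measure (K a) (space B) = 1"
    using kernel_prob_space[OF K a] prob_space.prob_space by metis
  then show ?thesis
    using channel_code_of_regions[OF K, of "{()}" "\<lambda>_. a" "\<lambda>_. space B" 0] a
    by (simp add: disjoint_family_on_def)
qed

lemma channel_avg_error_bounds:
  assumes K: "K \<in> A \<rightarrow>\<^sub>M prob_algebra B" and code: "channel_code A B m e d"
  shows "0 \<le> channel_avg_error K m e d"
    and "(\<And>i. i \<in> {1..m} \<Longrightarrow> channel_message_error K e d i \<le> c) \<Longrightarrow> channel_avg_error K m e d \<le> c"
proof -
  show "0 \<le> channel_avg_error K m e d"
    unfolding channel_avg_error_def using message_error_bounds(1)[OF K code]
    by (intro mult_nonneg_nonneg sum_nonneg) auto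
  assume "\<And>i. i \<in> {1..m} \<Longrightarrow> channel_message_error K e d i \<le> c"
  then have "(\<Sum>i=1..m. channel_message_error K e d i) \<le> (\<Sum>i=1..m. c)" by (intro sum_mono) auto
  moreover have "m \<ge> 1" using code by (simp add: channel_code_def)
  ultimately show "channel_avg_error K m e d \<le> c"
    by (simp add: channel_avg_error_def field_simps)
qed

text \<open>
  It suffices to have codes with small maximum error for large block lengths; for the others a code
  with a single message fills the gap.
\<close>

lemma achievable_channel_rateI:
  assumes W: "general_channel A B W" and ne: "\<And>n. n \<ge> 1 \<Longrightarrow> space (block A n) \<noteq> {}"
    and ev: "\<forall>\<^sub>F n in sequentially. \<exists>e d. channel_code (block A n) (block B n) (M n) e d \<and>
      (\<forall>i\<in>{1..M n}. channel_message_error (W n) e d i \<le> c n)"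
    and c: "c \<longlonglongrightarrow> 0"
    and R: "ereal R \<le> liminf (\<lambda>n. ereal (1 / real n * ln (real (M n))))"
  shows "achievable_channel_rate A B W R"
proof -
  have K: "W n \<in> block A n \<rightarrow>\<^sub>M prob_algebra (block B n)" if "n \<ge> 1" for n
    using W that by (simp add: general_channel_def)
  let ?good = "\<lambda>n m b e d. channel_code (block A n) (block B n) m e d \<and>
      (\<forall>i\<in>{1..m}. channel_message_error (W n) e d i \<le> b)"
  define M' where "M' n = (if \<exists>e d. ?good n (M n) (c n) e d then M n else 1)" for n
  define c' where "c' n = (if \<exists>e d. ?good n (M n) (c n) e d then c n else 0)" for n
  have "\<exists>e d. ?good n (M' n) (c' n) e d" if n: "n \<ge> 1" for n
  proof (cases "\<exists>e d. ?good n (M n) (c n) e d")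
    case True
    then show ?thesis unfolding M'_def c'_def by (simp only: if_True)
  next
    case False
    then show ?thesis unfolding M'_def c'_def
      using trivial_channel_code[OF K[OF n] ne[OF n]] by (simp only: if_False)
  qed
  then obtain e d where code: "\<And>n. n \<ge> 1 \<Longrightarrow> ?good n (M' n) (c' n) (e n) (d n)" by metis
  have eqM: "\<forall>\<^sub>F n in sequentially. M' n = M n" "\<forall>\<^sub>F n in sequentially. c' n = c n"
    using ev by (auto elim!: eventually_mono simp: M'_def c'_def)
  have c': "c' \<longlonglongrightarrow> 0" using c tendsto_cong[OF eqM(2)] by simp
  have "(\<lambda>n. channel_avg_error (W n) (M' n) (e n) (d n)) \<longlonglongrightarrow> 0"
  proof (rule tendsto_sandwich[OF _ _ tendsto_const c'])
    show "\<forall>\<^sub>F n in sequentially. 0 \<le> channel_avg_error (W n) (M' n) (e n) (d n)"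
      using eventually_ge_at_top[of 1]
      by eventually_elim (use K code channel_avg_error_bounds(1) in blast)
    show "\<forall>\<^sub>F n in sequentially. channel_avg_error (W n) (M' n) (e n) (d n) \<le> c' n"
      using eventually_ge_at_top[of 1]
      by eventually_elim (use K code in \<open>blast intro: channel_avg_error_bounds(2)\<close>)
  qed
  moreover have "liminf (\<lambda>n. ereal (1 / real n * ln (real (M' n))))
      = liminf (\<lambda>n. ereal (1 / real n * ln (real (M n))))"
    by (rule Liminf_eq) (use eqM(1) in \<open>auto elim: eventually_mono\<close>)
  ultimately show ?thesis
    unfolding achievable_channel_rate_def using code R by (intro exI[of _ M'] exI[of _ e] exI[of _ d]) auto
qed

lemma achievable_le_capacity: "achievable_channel_rate A B W R \<Longrightarrow> ereal R \<le> capacity A B W"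
  unfolding capacity_def by (intro Sup_upper) blast

lemma capacity_nonneg:
  assumes W: "general_channel A B W" and ne: "\<And>n. n \<ge> 1 \<Longrightarrow> space (block A n) \<noteq> {}"
  shows "0 \<le> capacity A B W"
proof -
  have "achievable_channel_rate A B W 0"
  proof (rule achievable_channel_rateI[OF W ne, where M="\<lambda>_. 1" and c="\<lambda>_. 0"])
    show "\<forall>\<^sub>F n in sequentially. \<exists>e d. channel_code (block A n) (block B n) 1 e d \<and>
        (\<forall>i\<in>{1..1}. channel_message_error (W n) e d i \<le> 0)"
      using eventually_ge_at_top[of 1]
      by eventually_elim (intro trivial_channel_code ne, use W in \<open>auto simp: general_channel_def\<close>)
    show "ereal 0 \<le> liminf (\<lambda>n. ereal (1 / real n * ln (real 1)))"
      by (rule liminf_log_rate[of 1]) auto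
  qed auto
  then show ?thesis using achievable_le_capacity zero_ereal_def by metis
qed

section \<open>The direct channel coding theorem\<close>

lemma information_rate_less_iff:
  assumes n: "n \<ge> 1"
  shows "information_rate A B W X n z < ereal \<alpha> \<longleftrightarrow>
    ext_RN_deriv (X n \<Otimes>\<^sub>M output_dist (X n) (W n)) (block_joint_dist A B W X n) z
      < ennreal (exp (real n * \<alpha>))"
proof -
  let ?f = "ext_RN_deriv (X n \<Otimes>\<^sub>M output_dist (X n) (W n)) (block_joint_dist A B W X n) z"
  have n0: "real n > 0" using n by simp
  show ?thesis
  proof (cases ?f rule: ennreal_cases)
    case (real r)
    show ?thesis
    proof (cases "r = 0")
      case True
      then show ?thesis using real n0 by (simp add: information_rate_def ln_ennreal_def)
    next
      case False
      then have r: "r > 0" using real by simp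
      have "information_rate A B W X n z = ereal (1 / real n * ln r)"
        using real r by (simp add: information_rate_def ln_ennreal_def)
      moreover have "1 / real n * ln r < \<alpha> \<longleftrightarrow> ln r < real n * \<alpha>" using n0 by (simp add: field_simps)
      moreover have "ln r < real n * \<alpha> \<longleftrightarrow> r < exp (real n * \<alpha>)"
        using r by (metis exp_less_cancel_iff exp_ln)
      ultimately show ?thesis using real by (simp add: ennreal_less_iff)
    qed
  next
    case top
    then show ?thesis using n0 by (simp add: information_rate_def ln_ennreal_def)
  qed
qed

lemma exp_decay: "\<gamma> > 0 \<Longrightarrow> (\<lambda>n. exp (- (real n * \<gamma>))) \<longlonglongrightarrow> (0::real)"
proof -
  assume "\<gamma> > 0"
  then have "(\<lambda>n. exp (- \<gamma>) ^ n) \<longlonglongrightarrow> 0" by (intro LIMSEQ_power_zero) simp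
  then show ?thesis by (simp add: exp_of_nat_mult[symmetric])
qed

lemma input_space_nonempty:
  assumes "P \<in> space (prob_algebra A)"
  shows "space A \<noteq> {}"
proof -
  interpret prob_space P using assms by (simp add: space_prob_algebra)
  show ?thesis using not_empty assms sets_eq_imp_space_eq[of P A] by (simp add: space_prob_algebra)
qed

text \<open>
  If the information rate is at least \<open>\<alpha>\<close> with probability tending to one, Feinstein's construction
  with threshold \<open>exp (n \<alpha>)\<close> gives codes with \<open>exp (n R)\<close> messages for each \<open>R < \<alpha>\<close>, as the term
  \<open>exp (n R) / exp (n \<alpha>)\<close> in its error bound decays.
\<close>

lemma inf_information_rate_le_capacity:
  assumes W: "general_channel A B W" and X: "X \<in> channel_inputs A"
  shows "inf_information_rate A B W X \<le> capacity A B W"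
  unfolding inf_information_rate_def p_liminf_def
proof (rule Sup_least)
  let ?p = "\<lambda>\<alpha> n. \<P>(\<omega> in block_joint_dist A B W X n. information_rate A B W X n \<omega> < ereal \<alpha>)"
  have K: "W n \<in> block A n \<rightarrow>\<^sub>M prob_algebra (block B n)" if "n \<ge> 1" for n
    using W that by (simp add: general_channel_def)
  have P: "X n \<in> space (prob_algebra (block A n))" if "n \<ge> 1" for n
    using X that by (simp add: channel_inputs_def)
  have ne: "space (block A n) \<noteq> {}" if "n \<ge> 1" for n
    by (rule input_space_nonempty[OF P[OF that]])
  fix a assume "a \<in> {ereal \<alpha> |\<alpha>. ?p \<alpha> \<longlonglongrightarrow> 0}"
  then obtain \<alpha> where a: "a = ereal \<alpha>" and p: "?p \<alpha> \<longlonglongrightarrow> 0" by blast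
  show "a \<le> capacity A B W"
  proof (rule ccontr)
    assume "\<not> a \<le> capacity A B W"
    then have "capacity A B W < ereal \<alpha>" by (simp add: a)
    then obtain R where R: "capacity A B W < ereal R" "ereal R < ereal \<alpha>"
      using ereal_dense2 by blast
    have "0 < ereal R" using capacity_nonneg[OF W ne] R(1) by (rule le_less_trans)
    then have Rpos: "R > 0" by simp
    define M where "M n = nat \<lceil>exp (real n * R)\<rceil>" for n
    (* The last summand makes the inequality in Feinstein's bound strict. *)
    define c where "c n = ?p \<alpha> n + 2 * exp (- (real n * (\<alpha> - R))) + 1 / real n" for n
    have "achievable_channel_rate A B W R"
    proof (rule achievable_channel_rateI[OF W ne, where M=M and c=c])
      show "\<forall>\<^sub>F n in sequentially. \<exists>e d. channel_code (block A n) (block B n) (M n) e d \<and>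
          (\<forall>i\<in>{1..M n}. channel_message_error (W n) e d i \<le> c n)"
        using eventually_ge_at_top[of 1]
      proof eventually_elim
        case (elim n)
        have "1 \<le> exp (real n * R)" using Rpos by simp
        then have M: "M n \<ge> 1" "real (M n) \<le> 2 * exp (real n * R)"
          unfolding M_def by linarith+
        have "real (M n) / exp (real n * \<alpha>) \<le> 2 * exp (real n * R) / exp (real n * \<alpha>)"
          using M(2) by (intro divide_right_mono) auto
        also have "\<dots> = 2 * exp (- (real n * (\<alpha> - R)))"
          by (simp add: right_diff_distrib exp_diff)
        also have "\<dots> < 2 * exp (- (real n * (\<alpha> - R))) + 1 / real n" using elim by simp
        finally have "?p \<alpha> n + real (M n) / exp (real n * \<alpha>) < c n" unfolding c_def by simp
        then show ?case
          unfolding information_rate_less_iff[OF elim]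
          by (intro feinstein_code[OF P[OF elim] K[OF elim] exp_gt_zero M(1)])
      qed
      have "c \<longlonglongrightarrow> 0 + 2 * 0 + 0"
        unfolding c_def using R by (intro tendsto_intros p exp_decay lim_1_over_n) auto
      then show "c \<longlonglongrightarrow> 0" by simp
      show "ereal R \<le> liminf (\<lambda>n. ereal (1 / real n * ln (real (M n))))"
        by (rule liminf_log_rate[of 1]) (auto simp: M_def real_nat_ceiling_ge)
    qed
    then show False using achievable_le_capacity R(1) by (metis leD)
  qed
qed

section \<open>The direct source coding theorem\<close>

lemma pmf_large_atoms:
  assumes q: "q > 0" and T: "\<And>v. v \<in> T \<Longrightarrow> q \<le> pmf P v"
  shows "finite T" "real (card T) \<le> 1 / q"
proof -
  have le: "real (card F) \<le> 1 / q" if F: "finite F" "F \<subseteq> T" for F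
  proof -
    have "real (card F) * q = (\<Sum>v\<in>F. q)" by simp
    also have "\<dots> \<le> (\<Sum>v\<in>F. pmf P v)" using F T by (intro sum_mono) auto
    also have "\<dots> = measure_pmf.prob P F" using F by (simp add: measure_measure_pmf_finite)
    also have "\<dots> \<le> 1" by simp
    finally show ?thesis using q by (simp add: field_simps)
  qed
  show "finite T"
  proof (rule ccontr)
    assume "infinite T"
    then obtain F where F: "finite F" "card F = nat \<lceil>1 / q\<rceil> + 1" "F \<subseteq> T"
      using infinite_arbitrarily_large by blast
    then show False using le[OF F(1,3)] by linarith
  qed
  then show "real (card T) \<le> 1 / q" by (rule le) simp
qed

lemma source_code_of_word_list:
  assumes T: "finite T" "T \<subseteq> words n"
  shows "\<exists>f g. source_code n (max 1 (card T)) f g \<and> (\<forall>v\<in>T. g (f v) = v)"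
proof -
  obtain k where k: "bij_betw k {1..card T} T" using ex_bij_betw_nat_finite_1[OF T(1)] by blast
  define f where "f v = (if v \<in> T then inv_into {1..card T} k v else 1)" for v
  define g where "g i = (if i \<in> {1..card T} then k i else replicate n undefined)" for i
  have inv: "inv_into {1..card T} k v \<in> {1..card T}" if "v \<in> T" for v
    using bij_betwE[OF bij_betw_inv_into[OF k]] that by blast
  have kT: "k i \<in> T" if "i \<in> {1..card T}" for i using bij_betwE[OF k] that by blast
  have "f v \<in> {1..max 1 (card T)}" for v using inv[of v] by (auto simp: f_def)
  moreover have "g i \<in> words n" for i using kT[of i] T(2) by (auto simp: g_def words_def)
  moreover have "g (f v) = v" if "v \<in> T" for v
    using inv[OF that] bij_betw_inv_into_right[OF k that] that by (simp add: f_def g_def)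
  ultimately show ?thesis unfolding source_code_def by blast
qed

text \<open>
  If the entropy rate is at most \<open>\<beta>\<close> with probability tending to one, it suffices to enumerate the
  words where this holds: each has probability at least \<open>exp (- n \<beta>)\<close>, so there are at most
  \<open>exp (n \<beta>)\<close> of them.
\<close>

lemma source_coding_rate_le_sup_entropy_rate:
  assumes V: "general_source V"
  shows "source_coding_rate V \<le> sup_entropy_rate V"
  unfolding sup_entropy_rate_def p_limsup_def
proof (rule Inf_greatest)
  let ?p = "\<lambda>\<beta> n. \<P>(v in measure_pmf (V n). entropy_rate V n v > ereal \<beta>)"
  fix b assume "b \<in> {ereal \<beta> |\<beta>. ?p \<beta> \<longlonglongrightarrow> 0}"
  then obtain \<beta> where b: "b = ereal \<beta>" and p: "?p \<beta> \<longlonglongrightarrow> 0" by blast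
  define T where "T n = {v \<in> set_pmf (V n). entropy_rate V n v \<le> ereal \<beta>}" for n
  have T: "finite (T n)" "real (card (T n)) \<le> exp (real n * \<beta>)" "T n \<subseteq> words n" if n: "n \<ge> 1" for n
  proof -
    have "exp (- (real n * \<beta>)) \<le> pmf (V n) v" if v: "v \<in> T n" for v
    proof -
      have pos: "pmf (V n) v > 0" using v by (simp add: T_def pmf_positive)
      then have "- ln (pmf (V n) v) \<le> real n * \<beta>"
        using v n by (simp add: T_def entropy_rate_def ln_div field_simps)
      then have "exp (- (real n * \<beta>)) \<le> exp (ln (pmf (V n) v))" by simp
      then show ?thesis using pos by simp
    qed
    from pmf_large_atoms[OF exp_gt_zero this] show "finite (T n)" "real (card (T n)) \<le> exp (real n * \<beta>)"
      by (auto simp: exp_minus field_simps)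
    show "T n \<subseteq> words n" using V n by (auto simp: T_def general_source_def)
  qed
  define M where "M n = max 1 (card (T n))" for n
  have "\<exists>f g. source_code n (M n) f g \<and> (\<forall>v\<in>T n. g (f v) = v)" if "n \<ge> 1" for n
    unfolding M_def by (rule source_code_of_word_list[OF T(1,3)[OF that]])
  then obtain f g where code: "\<And>n. n \<ge> 1 \<Longrightarrow> source_code n (M n) (f n) (g n)"
    and fg: "\<And>n v. n \<ge> 1 \<Longrightarrow> v \<in> T n \<Longrightarrow> g n (f n v) = v" by metis
  have "(\<lambda>n. source_error (V n) (f n) (g n)) \<longlonglongrightarrow> 0"
  proof (rule tendsto_sandwich[OF _ _ tendsto_const p])
    show "\<forall>\<^sub>F n in sequentially. 0 \<le> source_error (V n) (f n) (g n)"
      by (simp add: source_error_def)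
    show "\<forall>\<^sub>F n in sequentially. source_error (V n) (f n) (g n) \<le> ?p \<beta> n"
      using eventually_ge_at_top[of 1]
    proof eventually_elim
      case (elim n)
      have "ereal \<beta> < entropy_rate V n v" if "v \<in> set_pmf (V n)" "g n (f n v) \<noteq> v" for v
        by (rule ccontr) (use that fg[OF elim, of v] in \<open>simp add: T_def not_less\<close>)
      then show ?case unfolding source_error_def
        by (intro measure_pmf.finite_measure_mono_AE) (auto simp: AE_measure_pmf_iff)
    qed
  qed
  moreover have "limsup (\<lambda>n. ereal (1 / real n * ln (real (M n)))) \<le> ereal \<beta>"
  proof (rule Limsup_bounded)
    (* Eventually the list is nonempty, so that its length is the number of codewords. *)
    have "\<forall>\<^sub>F n in sequentially. ?p \<beta> n < 1" using p by (rule order_tendstoD) simp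
    then show "\<forall>\<^sub>F n in sequentially. ereal (1 / real n * ln (real (M n))) \<le> ereal \<beta>"
      using eventually_ge_at_top[of 1]
    proof eventually_elim
      case (elim n)
      have "T n \<noteq> {}"
      proof
        assume "T n = {}"
        then have "?p \<beta> n = 1"
          by (subst measure_pmf.prob_eq_1) (auto simp: AE_measure_pmf_iff T_def not_less[symmetric])
        then show False using elim by simp
      qed
      then have c: "card (T n) \<ge> 1" using T(1)[OF elim(2)] by (simp add: Suc_leI card_gt_0_iff)
      then have M: "M n = card (T n)" by (simp add: M_def)
      have "ln (real (M n)) \<le> real n * \<beta>"
        using c T(2)[OF elim(2)] unfolding M by (metis exp_gt_zero ln_exp ln_le_cancel_iff of_nat_0_less_iff less_le_trans zero_less_one)
      then show ?case using elim(2) by (simp add: field_simps)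
    qed
  qed
  ultimately have "achievable_source_rate V \<beta>"
    unfolding achievable_source_rate_def using code by blast
  then show "source_coding_rate V \<le> b" unfolding source_coding_rate_def b by (intro Inf_lower) blast
qed

section \<open>Separate coding below capacity\<close>

text \<open>
  An achievable source rate strictly below an achievable channel rate leaves an exponential gap between
  the numbers of messages, which absorbs the factor \<open>2\<close> lost by expurgation.
\<close>

lemma two_step_transmissible_if_rate_less_capacity:
  assumes V: "general_source V" and W: "general_channel A B W"
    and less: "source_coding_rate V < capacity A B W"
  shows "two_step_transmissible V A B W"
proof -
  have K: "W n \<in> block A n \<rightarrow>\<^sub>M prob_algebra (block B n)" if "n \<ge> 1" for n
    using W that by (simp add: general_channel_def)
  obtain R1 where R1: "achievable_source_rate V R1" "ereal R1 < capacity A B W"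
    using less unfolding source_coding_rate_def Inf_less_iff by blast
  obtain R2 where R2: "achievable_channel_rate A B W R2" "ereal R1 < ereal R2"
    using R1(2) unfolding capacity_def less_Sup_iff by blast
  obtain M f g where src: "\<And>n. n \<ge> 1 \<Longrightarrow> source_code n (M n) (f n) (g n)"
    and src_err: "(\<lambda>n. source_error (V n) (f n) (g n)) \<longlonglongrightarrow> 0"
    and src_rate: "limsup (\<lambda>n. ereal (1 / real n * ln (real (M n)))) \<le> ereal R1"
    using R1(1) unfolding achievable_source_rate_def by blast
  obtain N e d where ch: "\<And>n. n \<ge> 1 \<Longrightarrow> channel_code (block A n) (block B n) (N n) (e n) (d n)"
    and ch_err: "(\<lambda>n. channel_avg_error (W n) (N n) (e n) (d n)) \<longlonglongrightarrow> 0"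
    and ch_rate: "ereal R2 \<le> liminf (\<lambda>n. ereal (1 / real n * ln (real (N n))))"
    using R2(1) unfolding achievable_channel_rate_def by blast
  have ne: "space (block A n) \<noteq> {}" if "n \<ge> 1" for n
    using ch[OF that] unfolding channel_code_def by fastforce
  have M1: "M n \<ge> 1" if n: "n \<ge> 1" for n
  proof -
    have "f n (replicate n undefined) \<in> {1..M n}"
      using src[OF n] unfolding source_code_def by (auto simp: words_def)
    then show ?thesis by simp
  qed
  (* One third of the gap for each of the two rates, one third to absorb the factor 2. *)
  define \<gamma> where "\<gamma> = (R2 - R1) / 3"
  have \<gamma>: "\<gamma> > 0" using R2(2) by (simp add: \<gamma>_def)
  have "\<forall>\<^sub>F n in sequentially. exp (- (real n * \<gamma>)) < 1 / 2"
    using exp_decay[OF \<gamma>] by (rule order_tendstoD) simp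
  moreover have "\<forall>\<^sub>F n in sequentially. ereal (1 / real n * ln (real (M n))) < ereal (R1 + \<gamma>)"
    using le_less_trans[OF src_rate, of "ereal (R1 + \<gamma>)"] \<gamma> by (intro Limsup_lessD) simp
  moreover have "\<forall>\<^sub>F n in sequentially. ereal (R2 - \<gamma>) < ereal (1 / real n * ln (real (N n)))"
    using less_le_trans[OF _ ch_rate, of "ereal (R2 - \<gamma>)"] \<gamma> by (intro less_LiminfD) simp
  ultimately have half: "\<forall>\<^sub>F n in sequentially. 2 * M n \<le> N n"
    using eventually_ge_at_top[of 1]
  proof eventually_elim
    case (elim n)
    have n: "real n > 0" using elim by simp
    have N1: "real (N n) > 0" using ch[OF elim(4)] by (simp add: channel_code_def)
    have M0: "real (M n) > 0" using M1[OF elim(4)] by simp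
    have "ln (real (M n)) < real n * (R1 + \<gamma>)" using elim(2) n by (simp add: field_simps)
    then have "exp (ln (real (M n))) < exp (real n * (R1 + \<gamma>))" by simp
    then have M: "real (M n) < exp (real n * (R1 + \<gamma>))" using M0 by simp
    have "real n * (R2 - \<gamma>) < ln (real (N n))" using elim(3) n by (simp add: field_simps)
    then have "exp (real n * (R2 - \<gamma>)) < exp (ln (real (N n)))" by simp
    then have N: "exp (real n * (R2 - \<gamma>)) < real (N n)" using N1 by simp
    have "real n * (R1 + \<gamma>) = real n * (R2 - \<gamma>) + - (real n * \<gamma>)"
      by (simp add: \<gamma>_def field_simps)
    then have "exp (real n * (R1 + \<gamma>)) = exp (real n * (R2 - \<gamma>)) * exp (- (real n * \<gamma>))"
      by (simp only: exp_add)
    also have "\<dots> \<le> exp (real n * (R2 - \<gamma>)) * (1 / 2)"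
      using elim(1) by (intro mult_left_mono) auto
    finally show ?case using M N by linarith
  qed
  (* For the finitely many n for which M n is too large, both codes have a single message. *)
  define M' where "M' n = (if 2 * M n \<le> N n then M n else 1)" for n
  define c where "c n = (if 2 * M n \<le> N n then 2 * channel_avg_error (W n) (N n) (e n) (d n) else 0)" for n
  have "\<exists>e' d'. channel_code (block A n) (block B n) (M' n) e' d' \<and>
      (\<forall>i\<in>{1..M' n}. channel_message_error (W n) e' d' i \<le> c n)" if n: "n \<ge> 1" for n
  proof (cases "2 * M n \<le> N n")
    case True
    then show ?thesis unfolding M'_def c_def
      using expurgated_code[OF K[OF n] ch[OF n] M1[OF n]] by (simp only: if_True)
  next
    case False
    then show ?thesis unfolding M'_def c_def
      using trivial_channel_code[OF K[OF n] ne[OF n]] by (simp only: if_False)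
  qed
  then obtain e' d' where code: "\<And>n. n \<ge> 1 \<Longrightarrow> channel_code (block A n) (block B n) (M' n) (e' n) (d' n)"
    and msg: "\<And>n i. n \<ge> 1 \<Longrightarrow> i \<in> {1..M' n} \<Longrightarrow> channel_message_error (W n) (e' n) (d' n) i \<le> c n"
    by metis
  define f' where "f' n = (if 2 * M n \<le> N n then f n else (\<lambda>_. 1))" for n
  define g' where "g' n = (if 2 * M n \<le> N n then g n else (\<lambda>_. replicate n undefined))" for n
  have src': "source_code n (M' n) (f' n) (g' n)" if "n \<ge> 1" for n
    using src[OF that] by (auto simp: source_code_def M'_def f'_def g'_def words_def)
  have src_err': "(\<lambda>n. source_error (V n) (f' n) (g' n)) \<longlonglongrightarrow> 0"
  proof (rule Lim_transform_eventually[OF src_err])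
    show "\<forall>\<^sub>F n in sequentially. source_error (V n) (f n) (g n) = source_error (V n) (f' n) (g' n)"
      using half by eventually_elim (simp add: f'_def g'_def)
  qed
  have c: "c \<longlonglongrightarrow> 0"
  proof (rule Lim_transform_eventually)
    show "(\<lambda>n. 2 * channel_avg_error (W n) (N n) (e n) (d n)) \<longlonglongrightarrow> 0"
      using tendsto_mult_right_zero[OF ch_err] .
    show "\<forall>\<^sub>F n in sequentially. 2 * channel_avg_error (W n) (N n) (e n) (d n) = c n"
      using half by eventually_elim (simp add: c_def)
  qed
  have max_err: "(\<lambda>n. channel_max_error (W n) (M' n) (e' n) (d' n)) \<longlonglongrightarrow> 0"
  proof (rule tendsto_sandwich[OF _ _ tendsto_const c])
    show "\<forall>\<^sub>F n in sequentially. 0 \<le> channel_max_error (W n) (M' n) (e' n) (d' n)"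
      using eventually_ge_at_top[of 1]
    proof eventually_elim
      case (elim n)
      have one: "1 \<in> {1..M' n}" using code[OF elim] by (simp add: channel_code_def)
      have "0 \<le> channel_message_error (W n) (e' n) (d' n) 1"
        by (rule message_error_bounds(1)[OF K[OF elim] code[OF elim] one])
      also have "\<dots> \<le> channel_max_error (W n) (M' n) (e' n) (d' n)"
        unfolding channel_max_error_def using one by (intro Max_ge) auto
      finally show ?case .
    qed
    show "\<forall>\<^sub>F n in sequentially. channel_max_error (W n) (M' n) (e' n) (d' n) \<le> c n"
      using eventually_ge_at_top[of 1]
    proof eventually_elim
      case (elim n)
      have "{1..M' n} \<noteq> {}" using code[OF elim] by (simp add: channel_code_def)
      then show ?case unfolding channel_max_error_def using msg[OF elim] by (subst Max_le_iff) auto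
    qed
  qed
  have joint: "joint_code A B n (e' n \<circ> f' n) (g' n \<circ> d' n)" if n: "n \<ge> 1" for n
  proof -
    have "g' n \<in> count_space {1..M' n} \<rightarrow>\<^sub>M count_space (words n)"
      using src'[OF n] by (simp add: source_code_def)
    then have "g' n \<circ> d' n \<in> block B n \<rightarrow>\<^sub>M count_space (words n)"
      using code[OF n] by (auto simp: channel_code_def intro: measurable_comp)
    then show ?thesis using src'[OF n] code[OF n]
      unfolding joint_code_def source_code_def channel_code_def by auto
  qed
  have supp: "set_pmf (V n) \<subseteq> words n" if "n \<ge> 1" for n
    using V that by (simp add: general_source_def)
  have "(\<lambda>n. joint_error (V n) (W n) n (e' n \<circ> f' n) (g' n \<circ> d' n)) \<longlonglongrightarrow> 0"
  proof (rule tendsto_sandwich[OF _ _ tendsto_const])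
    show "(\<lambda>n. source_error (V n) (f' n) (g' n) + c n) \<longlonglongrightarrow> 0"
      using tendsto_add[OF src_err' c] by simp
    show "\<forall>\<^sub>F n in sequentially. 0 \<le> joint_error (V n) (W n) n (e' n \<circ> f' n) (g' n \<circ> d' n)"
      using eventually_ge_at_top[of 1]
    proof eventually_elim
      case (elim n)
      show ?case using joint[OF elim]
        by (intro joint_error_nonneg[OF supp[OF elim] K[OF elim]]) (simp add: joint_code_def)
    qed
    show "\<forall>\<^sub>F n in sequentially. joint_error (V n) (W n) n (e' n \<circ> f' n) (g' n \<circ> d' n)
        \<le> source_error (V n) (f' n) (g' n) + c n"
      using eventually_ge_at_top[of 1]
    proof eventually_elim
      case (elim n)
      show ?case
        by (rule two_step_joint_error[OF supp[OF elim] K[OF elim] src'[OF elim] code[OF elim] msg[OF elim]])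
    qed
  qed
  then have "transmits V A B W (\<lambda>n. e' n \<circ> f' n) (\<lambda>n. g' n \<circ> d' n)"
    unfolding transmits_def using joint by blast
  then show ?thesis
    unfolding two_step_transmissible_def
    using src' src_err' code max_err by blast
qed

section \<open>Transmissibility forces the entropy rate below capacity\<close>

text \<open>
  The summand \<open>1 / n\<close> keeps the error threshold positive when the joint code makes no error.
\<close>

lemma channel_code_of_transmission:
  assumes V: "general_source V" and W: "general_channel A B W" and tr: "transmits V A B W \<phi> \<psi>"
    and n: "n \<ge> 1" and \<delta>: "\<delta> > 0" "\<delta> \<le> \<P>(v in measure_pmf (V n). entropy_rate V n v > ereal R)"
  shows "\<exists>e d. channel_code (block A n) (block B n) (nat \<lceil>\<delta> / 2 * exp (real n * R)\<rceil>) e d \<and>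
    (\<forall>i\<in>{1..nat \<lceil>\<delta> / 2 * exp (real n * R)\<rceil>}. channel_message_error (W n) e d i
      \<le> 2 / \<delta> * joint_error (V n) (W n) n (\<phi> n) (\<psi> n) + 1 / real n)"
proof -
  let ?T = "{v. entropy_rate V n v > ereal R}" and ?\<epsilon> = "joint_error (V n) (W n) n (\<phi> n) (\<psi> n)"
  have K: "W n \<in> block A n \<rightarrow>\<^sub>M prob_algebra (block B n)"
    using W n by (simp add: general_channel_def)
  have supp: "set_pmf (V n) \<subseteq> words n" using V n by (simp add: general_source_def)
  have code: "joint_code A B n (\<phi> n) (\<psi> n)" using tr n by (simp add: transmits_def)
  have \<epsilon>: "0 \<le> ?\<epsilon>" using code by (intro joint_error_nonneg[OF supp K]) (simp add: joint_code_def)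
  have small: "pmf (V n) v \<le> exp (- (real n * R))" if v: "v \<in> ?T" for v
  proof (cases "pmf (V n) v = 0")
    case False
    then have pos: "pmf (V n) v > 0" by (simp add: pmf_nonneg order_less_le)
    have "R < 1 / real n * ln (1 / pmf (V n) v)" using v by (simp add: entropy_rate_def)
    then have "ln (pmf (V n) v) < - (real n * R)" using n pos by (simp add: ln_div field_simps)
    then have "exp (ln (pmf (V n) v)) < exp (- (real n * R))" by simp
    then show ?thesis using pos by simp
  qed simp
  have c: "0 < 2 / \<delta> * ?\<epsilon> + 1 / real n" using \<delta> \<epsilon> n by (intro add_nonneg_pos) auto
  have "?\<epsilon> \<le> (2 / \<delta> * ?\<epsilon> + 1 / real n) * \<delta> / 2" using \<delta> n by (simp add: field_simps)
  moreover have "\<delta> \<le> measure_pmf.prob (V n) ?T" using \<delta>(2) by simp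
  ultimately have "\<exists>e d. channel_code (block A n) (block B n)
      (nat \<lceil>\<delta> / (2 * exp (- (real n * R)))\<rceil>) e d \<and>
    (\<forall>i\<in>{1..nat \<lceil>\<delta> / (2 * exp (- (real n * R)))\<rceil>}. channel_message_error (W n) e d i
      \<le> 2 / \<delta> * ?\<epsilon> + 1 / real n)"
    by (intro channel_code_of_joint_code[OF supp K code exp_gt_zero small \<delta>(1) _ c])
  moreover have "\<delta> / (2 * exp (- (real n * R))) = \<delta> / 2 * exp (real n * R)"
    by (simp add: exp_minus field_simps)
  ultimately show ?thesis by simp
qed

lemma p_limsup_le: "(\<lambda>n. \<P>(\<omega> in M n. Z n \<omega> > ereal \<beta>)) \<longlonglongrightarrow> 0 \<Longrightarrow> p_limsup M Z \<le> ereal \<beta>"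
  unfolding p_limsup_def by (intro Inf_lower) blast

lemma p_liminf_ge: "(\<lambda>n. \<P>(\<omega> in M n. Z n \<omega> < ereal \<alpha>)) \<longlonglongrightarrow> 0 \<Longrightarrow> ereal \<alpha> \<le> p_liminf M Z"
  unfolding p_liminf_def by (intro Sup_upper) blast

text \<open>
  If the probabilities came arbitrarily close to zero, they would tend to zero along a subsequence,
  and the limit superior in probability along it would be at most \<open>R\<close>.
\<close>

lemma semi_strong_source_eventually:
  assumes V: "semi_strong_converse_source V" and R: "ereal R < sup_entropy_rate V"
  shows "\<exists>\<delta>>0. \<forall>\<^sub>F n in sequentially. \<delta> \<le> \<P>(v in measure_pmf (V n). entropy_rate V n v > ereal R)"
proof -
  let ?p = "\<lambda>n. \<P>(v in measure_pmf (V n). entropy_rate V n v > ereal R)"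
  (* The shift makes all block lengths positive, as the converse property requires. *)
  let ?u = "\<lambda>n. ereal (?p (Suc n))"
  obtain r :: "nat \<Rightarrow> nat" where r: "strict_mono r" "(?u \<circ> r) \<longlonglongrightarrow> liminf ?u"
    using liminf_subseq_lim by blast
  have "\<not> liminf ?u \<le> 0"
  proof
    assume "liminf ?u \<le> 0"
    moreover have "0 \<le> liminf ?u" by (rule Liminf_bounded) (simp add: zero_ereal_def)
    ultimately have "liminf ?u = ereal 0" by (simp add: zero_ereal_def antisym)
    then have "(\<lambda>i. ?p (Suc (r i))) \<longlonglongrightarrow> 0" using r(2) by (simp add: comp_def)
    then have "p_limsup (\<lambda>i. measure_pmf (V (Suc (r i)))) (\<lambda>i. entropy_rate V (Suc (r i))) \<le> ereal R"
      by (rule p_limsup_le)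
    moreover have "strict_mono (\<lambda>i. Suc (r i))" using r(1) by (simp add: strict_mono_def)
    then have "p_limsup (\<lambda>i. measure_pmf (V (Suc (r i)))) (\<lambda>i. entropy_rate V (Suc (r i))) = sup_entropy_rate V"
      using V unfolding semi_strong_converse_source_def by simp
    ultimately show False using R by simp
  qed
  then obtain \<delta> where \<delta>: "0 < ereal \<delta>" "ereal \<delta> < liminf ?u"
    using ereal_dense2[of 0 "liminf ?u"] by (auto simp: not_le)
  have "\<forall>\<^sub>F n in sequentially. ereal \<delta> < ?u n" using \<delta>(2) by (rule less_LiminfD)
  then have "\<forall>\<^sub>F n in sequentially. \<delta> \<le> ?p (Suc n)" by (auto elim: eventually_mono)
  then have "\<forall>\<^sub>F n in sequentially. \<delta> \<le> ?p n"
    using eventually_sequentially_Suc[of "\<lambda>n. \<delta> \<le> ?p n"] by simp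
  then show ?thesis using \<delta>(1) by auto
qed

lemma transmission_input_nonempty:
  assumes "transmits V A B W \<phi> \<psi>" "n \<ge> 1"
  shows "space (block A n) \<noteq> {}"
proof -
  have "\<phi> n \<in> words n \<rightarrow> space (block A n)" using assms by (simp add: transmits_def joint_code_def)
  moreover have "replicate n undefined \<in> words n" by (simp add: words_def)
  ultimately show ?thesis by (metis PiE empty_iff)
qed

lemma transmission_bound_tendsto_zero:
  assumes "transmits V A B W \<phi> \<psi>"
  shows "(\<lambda>n. 2 / \<delta> * joint_error (V n) (W n) n (\<phi> n) (\<psi> n) + 1 / real n) \<longlonglongrightarrow> 0"
proof -
  have "(\<lambda>n. joint_error (V n) (W n) n (\<phi> n) (\<psi> n)) \<longlonglongrightarrow> 0" using assms by (simp add: transmits_def)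
  then have "(\<lambda>n. 2 / \<delta> * joint_error (V n) (W n) n (\<phi> n) (\<psi> n) + 1 / real n) \<longlonglongrightarrow> 2 / \<delta> * 0 + 0"
    by (intro tendsto_intros lim_1_over_n)
  then show ?thesis by simp
qed

text \<open>
  The same \<open>\<delta>\<close> works for all large block lengths, so the transmission yields channel codes of rate
  \<open>R\<close> for every \<open>R\<close> below the sup-entropy rate.
\<close>

lemma entropy_rate_le_capacity_of_semi_strong_source:
  assumes V: "general_source V" and W: "general_channel A B W" and tr: "transmits V A B W \<phi> \<psi>"
    and semi: "semi_strong_converse_source V"
  shows "sup_entropy_rate V \<le> capacity A B W"
proof (rule ccontr)
  assume "\<not> ?thesis"
  then have "capacity A B W < sup_entropy_rate V" by simp
  then obtain R where R: "capacity A B W < ereal R" "ereal R < sup_entropy_rate V"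
    using ereal_dense2 by blast
  obtain \<delta> where \<delta>: "\<delta> > 0"
    and ev: "\<forall>\<^sub>F n in sequentially. \<delta> \<le> \<P>(v in measure_pmf (V n). entropy_rate V n v > ereal R)"
    using semi_strong_source_eventually[OF semi R(2)] by blast
  have "achievable_channel_rate A B W R"
  proof (rule achievable_channel_rateI[OF W transmission_input_nonempty[OF tr]])
    show "\<forall>\<^sub>F n in sequentially. \<exists>e d.
        channel_code (block A n) (block B n) (nat \<lceil>\<delta> / 2 * exp (real n * R)\<rceil>) e d \<and>
        (\<forall>i\<in>{1..nat \<lceil>\<delta> / 2 * exp (real n * R)\<rceil>}. channel_message_error (W n) e d i
          \<le> 2 / \<delta> * joint_error (V n) (W n) n (\<phi> n) (\<psi> n) + 1 / real n)"
      using ev eventually_ge_at_top[of 1]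
      by eventually_elim (rule channel_code_of_transmission[OF V W tr _ \<delta>])
    show "ereal R \<le> liminf (\<lambda>n. ereal (1 / real n * ln (real (nat \<lceil>\<delta> / 2 * exp (real n * R)\<rceil>))))"
      by (rule liminf_log_rate[of "\<delta> / 2"]) (use \<delta> real_nat_ceiling_ge in auto)
  qed (assumption | rule transmission_bound_tendsto_zero[OF tr])+
  then show False using achievable_le_capacity R(1) by (metis leD)
qed

text \<open>
  Here \<open>\<delta>\<close> is available only along a subsequence, so the codes do not witness an achievable rate.
  Instead they define an input whose information rate exceeds the capacity along that subsequence,
  against the converse property.
\<close>

lemma entropy_rate_le_capacity_of_semi_strong_channel:
  assumes V: "general_source V" and W: "general_channel A B W" and tr: "transmits V A B W \<phi> \<psi>"
    and semi: "semi_strong_converse_channel A B W"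
  shows "sup_entropy_rate V \<le> capacity A B W"
proof (rule ccontr)
  assume "\<not> ?thesis"
  then have "capacity A B W < sup_entropy_rate V" by simp
  then obtain R where R: "capacity A B W < ereal R" "ereal R < sup_entropy_rate V"
    using ereal_dense2 by blast
  obtain R' where R': "capacity A B W < ereal R'" "ereal R' < ereal R"
    using ereal_dense2[OF R(1)] by blast
  have K: "W n \<in> block A n \<rightarrow>\<^sub>M prob_algebra (block B n)" if "n \<ge> 1" for n
    using W that by (simp add: general_channel_def)
  let ?p = "\<lambda>n. \<P>(v in measure_pmf (V n). entropy_rate V n v > ereal R)"
  have "\<not> ?p \<longlonglongrightarrow> 0"
  proof
    assume "?p \<longlonglongrightarrow> 0"
    then have "sup_entropy_rate V \<le> ereal R" unfolding sup_entropy_rate_def by (rule p_limsup_le)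
    then show False using R(2) by simp
  qed
  then obtain \<delta> where \<delta>: "\<delta> > 0" and nev: "\<not> (\<forall>\<^sub>F n in sequentially. dist (?p n) 0 < \<delta>)"
    unfolding tendsto_iff by blast
  define N where "N = {n. 1 \<le> n \<and> \<delta> \<le> ?p n}"
  have "infinite N"
  proof
    assume "finite N"
    then have "\<forall>\<^sub>F n in sequentially. n \<notin> N"
      by (simp add: cofinite_eq_sequentially[symmetric] eventually_cofinite)
    then have "\<forall>\<^sub>F n in sequentially. dist (?p n) 0 < \<delta>"
      using eventually_ge_at_top[of 1] by eventually_elim (simp add: N_def not_le)
    then show False using nev by blast
  qed
  then obtain k :: "nat \<Rightarrow> nat" where k: "strict_mono k" "\<And>i. k i \<in> N"
    using infinite_enumerate by blast
  have k1: "k i \<ge> 1" for i using k(2)[of i] by (simp add: N_def)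
  define M where "M n = nat \<lceil>\<delta> / 2 * exp (real n * R)\<rceil>" for n
  define c where "c n = 2 / \<delta> * joint_error (V n) (W n) n (\<phi> n) (\<psi> n) + 1 / real n" for n
  have "\<exists>e d. channel_code (block A n) (block B n) (M n) e d \<and>
      (\<forall>i\<in>{1..M n}. channel_message_error (W n) e d i \<le> c n)" if "n \<in> N" for n
    unfolding M_def c_def using that
    by (intro channel_code_of_transmission[OF V W tr _ \<delta>]) (auto simp: N_def)
  then obtain e d where code: "\<And>n. n \<in> N \<Longrightarrow> channel_code (block A n) (block B n) (M n) (e n) (d n)"
    and msg: "\<And>n i. n \<in> N \<Longrightarrow> i \<in> {1..M n} \<Longrightarrow> channel_message_error (W n) (e n) (d n) i \<le> c n"
    by metis
  (* Off the subsequence the input is arbitrary, since only its values on N matter. *)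
  define X where "X n = (if n \<in> N then distr (uniform_count_measure {1..M n}) (block A n) (e n)
    else return (block A n) (SOME x. x \<in> space (block A n)))" for n
  have X: "X \<in> channel_inputs A"
    unfolding channel_inputs_def
  proof (intro CollectI allI impI)
    fix n :: nat assume n: "n \<ge> 1"
    have "(SOME x. x \<in> space (block A n)) \<in> space (block A n)"
      using transmission_input_nonempty[OF tr n] by (simp add: some_in_eq)
    then have "return (block A n) (SOME x. x \<in> space (block A n)) \<in> space (prob_algebra (block A n))"
      by (simp add: space_prob_algebra prob_space_return)
    then show "X n \<in> space (prob_algebra (block A n))"
      using uniform_codeword_law(1)[OF code] by (simp add: X_def)
  qed
  let ?s = "\<lambda>n. \<P>(z in block_joint_dist A B W X n. information_rate A B W X n z < ereal R')"
  define b where "b n = c n + 2 / \<delta> * exp (- (real n * (R - R')))" for n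
  have c0: "c \<longlonglongrightarrow> 0" unfolding c_def by (rule transmission_bound_tendsto_zero[OF tr])
  have "b \<longlonglongrightarrow> 0 + 2 / \<delta> * 0"
    unfolding b_def using R'(2) by (intro tendsto_intros c0 exp_decay) auto
  then have b0: "b \<longlonglongrightarrow> 0" by simp
  have s: "?s n \<le> b n" if n: "n \<in> N" and cn: "c n < 1 / 2" for n
  proof -
    have n1: "n \<ge> 1" using n by (simp add: N_def)
    have Xn: "X n = distr (uniform_count_measure {1..M n}) (block A n) (e n)"
      using n by (simp add: X_def)
    have "?s n \<le> c n + exp (real n * R') / M n"
      unfolding information_rate_less_iff[OF n1] unfolding Xn
      by (rule uniform_codeword_density[OF K[OF n1] code[OF n] msg[OF n] cn]) auto
    also have "exp (real n * R') / M n \<le> exp (real n * R') / (\<delta> / 2 * exp (real n * R))"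
      using \<delta> by (intro divide_left_mono) (auto simp: M_def real_nat_ceiling_ge intro!: mult_pos_pos)
    also have "\<dots> = 2 / \<delta> * exp (- (real n * (R - R')))"
      by (simp add: right_diff_distrib exp_diff)
    finally show ?thesis unfolding b_def by simp
  qed
  have "(\<lambda>i. ?s (k i)) \<longlonglongrightarrow> 0"
  proof (rule tendsto_sandwich[OF _ _ tendsto_const])
    show "(\<lambda>i. b (k i)) \<longlonglongrightarrow> 0" using LIMSEQ_subseq_LIMSEQ[OF b0 k(1)] by (simp add: comp_def)
    have "(\<lambda>i. c (k i)) \<longlonglongrightarrow> 0" using LIMSEQ_subseq_LIMSEQ[OF c0 k(1)] by (simp add: comp_def)
    then have "\<forall>\<^sub>F i in sequentially. c (k i) < 1 / 2" by (rule order_tendstoD) simp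
    then show "\<forall>\<^sub>F i in sequentially. ?s (k i) \<le> b (k i)"
      by eventually_elim (rule s[OF k(2)])
  qed simp
  then have "ereal R' \<le> p_liminf (\<lambda>i. block_joint_dist A B W X (k i)) (\<lambda>i. information_rate A B W X (k i))"
    by (rule p_liminf_ge)
  also have "\<dots> \<le> (SUP X'\<in>channel_inputs A. inf_information_rate A B W X')"
    using semi X k(1) k1 unfolding semi_strong_converse_channel_def by blast
  also have "\<dots> \<le> capacity A B W" by (intro SUP_least inf_information_rate_le_capacity[OF W])
  finally show False using R'(1) by simp
qed

theorem theorem6p7:
  fixes V :: "nat \<Rightarrow> 'v::countable list pmf"
    and A :: "'x measure"
    and B :: "'y measure"
    and W :: "nat \<Rightarrow> (nat \<Rightarrow> 'x) \<Rightarrow> (nat \<Rightarrow> 'y) measure"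
  assumes "infinite (UNIV :: 'v set)"
    and "general_source V"
    and "general_channel A B W"
    and "semi_strong_converse_source V \<or> semi_strong_converse_channel A B W"
  shows "(source_coding_rate V < capacity A B W \<longrightarrow>
            transmissible V A B W \<and> two_step_transmissible V A B W) \<and>
         (transmissible V A B W \<longrightarrow> source_coding_rate V \<le> capacity A B W)"
proof (intro conjI impI)
  assume less: "source_coding_rate V < capacity A B W"
  show two: "two_step_transmissible V A B W"
    by (rule two_step_transmissible_if_rate_less_capacity[OF assms(2,3) less])
  then show "transmissible V A B W"
    unfolding two_step_transmissible_def transmissible_def by blast
next
  assume "transmissible V A B W"
  then obtain \<phi> \<psi> where tr: "transmits V A B W \<phi> \<psi>" unfolding transmissible_def by blast
  have "source_coding_rate V \<le> sup_entropy_rate V"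
    by (rule source_coding_rate_le_sup_entropy_rate[OF assms(2)])
  also have "\<dots> \<le> capacity A B W"
    using assms(4) entropy_rate_le_capacity_of_semi_strong_source[OF assms(2,3) tr]
      entropy_rate_le_capacity_of_semi_strong_channel[OF assms(2,3) tr] by blast
  finally show "source_coding_rate V \<le> capacity A B W" .
qed

end
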